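(* Let $f\colon M_0\times M_1\to \mathbb{R}^m$ be the Ribaucour partial tube determined by $(f_0,f_1,\Psi,\varphi,\beta)$ and let $\mathcal{E} = (E_0, E_1)$ be the product net of $M=M_0\times M_1$. Then the following assertions hold: (i) The net $\mathcal{E}$ is orthogonal with respect to the metric induced by $f$. (ii) The second fundamental form of $f$ is adapted to $\mathcal{E}$. (iii) $E_0$ is a spherical distribution (with respect to the metric induced by $f$).
   Context: Product net: for $M=M_0\times M_1$, $E_0$ and $E_1$ are the distributions formed by the tangent spaces of the factors. It is orthogonal if $E_0\perp E_1$. The second fundamental form $\alpha^f$ is adapted to $(E_0,E_1)$ if $\alpha^f(X_0,X_1)=0$ whenever $X_0\in\Gamma(E_0)$, $X_1\in\Gamma(E_1)$. Spherical distribution: a subbundle $E\subset TM$ of a Riemannian manifold is umbilical if there is $Z\in\Gamma(E^\perp)$ (its mean curvature vector field) with $(\nabla_TS)_{E^\perp}=\langle T,S\rangle Z$ for all $T,S\in\Gamma(E)$; it is spherical if moreover $(\nabla_TZ)_{E^\perp}=0$ for all $T\in\Gamma(E)$. For an isometric immersion $h\colon M\to\mathbb{R}^m$, $N_hM$, $\nabla^\perp$, $\alpha^h$ denote its normal bundle, normal connection and second fundamental form, and $\mathcal{D}(h)$ is the set of pairs $(\varphi,\beta)$, $\varphi\in C^\infty(M)$, $\beta\in\Gamma(N_hM)$, with $\alpha^h(\mathrm{grad}\,\varphi,X)+\nabla^\perp_X\beta=0$ for all $X\in\mathfrak{X}(M)$. Ribaucour partial tube: let $f_1\colon M_1\to\mathbb{R}^m$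 be an isometric immersion with an orthonormal set $\xi_1,\dots,\xi_k$ of normal vector fields that are parallel in the normal connection, $\mathcal{L}=\mathrm{span}\{\xi_1,\dots,\xi_k\}$, and $\Psi\colon M_1\times\mathbb{R}^k\to\mathcal{L}$ the parallel vector bundle isometry $\Psi(x_1,y)=\Psi_{x_1}(y)=\sum_i y_i\xi_i(x_1)$. Let $f_0\colon M_0\to\mathbb{R}^k$ be an isometric immersion (always assumed substantial, i.e. not contained in a proper affine subspace), and $(\varphi,\beta)\in\mathcal{D}(f_1)$. Put $\mathcal{F}_{x_0}=f_{1*}\mathrm{grad}\,\varphi+\beta+\Psi(f_0(x_0))$, where $\Psi(y)(x_1)=\Psi_{x_1}(y)$, and $\nu_{x_0}=\|\mathcal{F}_{x_0}\|^{-2}$. If the map $$f(x_0,x_1)=(f_1-2\nu_{x_0}\varphi\mathcal{F}_{x_0})(x_1)$$ on $M_0\times M_1$ is an immersion, it is called the Ribaucour partial tube over $f_1$ with fiber $f_0$ determined by $(f_0,f_1,\Psi,\varphi,\beta)$. *)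

theory Defs
  imports "HOL-Analysis.Analysis"
begin

section \<open>Smooth manifolds\<close>

text \<open>Only meant for open \<open>S\<close>.\<close>

primrec Ck_on :: "nat \<Rightarrow> 'a::real_normed_vector set \<Rightarrow> ('a \<Rightarrow> 'b::real_normed_vector) \<Rightarrow> bool" where
  "Ck_on 0 S f \<longleftrightarrow> continuous_on S f"
| "Ck_on (Suc n) S f \<longleftrightarrow>
     (\<forall>x\<in>S. f differentiable (at x)) \<and> (\<forall>v. Ck_on n S (\<lambda>x. frechet_derivative f (at x) v))"

definition smooth_on :: "'a::real_normed_vector set \<Rightarrow> ('a \<Rightarrow> 'b::real_normed_vector) \<Rightarrow> bool" where
  "smooth_on S f \<longleftrightarrow> (\<forall>n. Ck_on n S f)"

text \<open>
  A manifold is a type of points with an atlas indexed by the points: \<open>A p\<close> is a chart (domain and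
  coordinate map) around \<open>p\<close>. Every smooth structure is given by such an atlas.
  The chart \<open>A p\<close> also serves to identify the tangent space at \<open>p\<close> with the model
  space \<open>'a\<close>, so that tangent vectors are elements of \<open>'a\<close> and vector fields are functions \<open>'p \<Rightarrow> 'a\<close>.
\<close>

type_synonym ('p, 'a) atlas = "'p \<Rightarrow> 'p set \<times> ('p \<Rightarrow> 'a)"

definition cdom :: "('p, 'a) atlas \<Rightarrow> 'p \<Rightarrow> 'p set" where
  "cdom A p = fst (A p)"

definition coord :: "('p, 'a) atlas \<Rightarrow> 'p \<Rightarrow> 'p \<Rightarrow> 'a" where
  "coord A p = snd (A p)"

definition icoord :: "('p, 'a) atlas \<Rightarrow> 'p \<Rightarrow> 'a \<Rightarrow> 'p" where
  "icoord A p = inv_into (cdom A p) (coord A p)"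

definition smooth_manifold ::
  "('p::{t2_space, second_countable_topology}, 'a::euclidean_space) atlas \<Rightarrow> bool" where
  "smooth_manifold A \<longleftrightarrow>
     (\<forall>p. p \<in> cdom A p \<and> open (cdom A p) \<and> open (coord A p ` cdom A p) \<and>
          homeomorphism (cdom A p) (coord A p ` cdom A p) (coord A p) (icoord A p)) \<and>
     (\<forall>p q. smooth_on (coord A p ` (cdom A p \<inter> cdom A q)) (coord A q \<circ> icoord A p))"

definition prod_atlas :: "('p, 'a) atlas \<Rightarrow> ('q, 'b) atlas \<Rightarrow> ('p \<times> 'q, 'a \<times> 'b) atlas" where
  "prod_atlas A B = (\<lambda>(p, q). (cdom A p \<times> cdom B q, \<lambda>(x, y). (coord A p x, coord B q y)))"

definition smooth_map :: "('p, 'a::euclidean_space) atlas \<Rightarrow> ('p \<Rightarrow> 'c::real_normed_vector) \<Rightarrow> bool" where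
  "smooth_map A F \<longleftrightarrow> (\<forall>q. smooth_on (coord A q ` cdom A q) (F \<circ> icoord A q))"

text \<open>
  \<open>differential A F p v\<close> is \<open>dF\<^sub>p v\<close>. Only the germ of \<open>F\<close> at \<open>p\<close> matters, so this may also be applied
  to a coordinate map \<open>coord A q\<close> at points \<open>p \<in> cdom A q\<close>: it then gives the coordinates of \<open>v\<close> with
  respect to the chart \<open>A q\<close>.
\<close>

definition differential ::
  "('p, 'a::euclidean_space) atlas \<Rightarrow> ('p \<Rightarrow> 'c::real_normed_vector) \<Rightarrow> 'p \<Rightarrow> 'a \<Rightarrow> 'c" where
  "differential A F p v = frechet_derivative (F \<circ> icoord A p) (at (coord A p p)) v"

definition smooth_vf_on :: "('p, 'a::euclidean_space) atlas \<Rightarrow> 'p set \<Rightarrow> ('p \<Rightarrow> 'a) \<Rightarrow> bool" where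
  "smooth_vf_on A U X \<longleftrightarrow>
     (\<forall>q. smooth_on (coord A q ` (U \<inter> cdom A q))
            ((\<lambda>p. differential A (coord A q) p (X p)) \<circ> icoord A q))"

abbreviation smooth_vf :: "('p, 'a::euclidean_space) atlas \<Rightarrow> ('p \<Rightarrow> 'a) \<Rightarrow> bool" where
  "smooth_vf A X \<equiv> smooth_vf_on A UNIV X"

section \<open>Riemannian metrics and the Levi-Civita connection\<close>

type_synonym ('p, 'a) metric = "'p \<Rightarrow> 'a \<Rightarrow> 'a \<Rightarrow> real"

definition riemannian_metric :: "('p, 'a::euclidean_space) atlas \<Rightarrow> ('p, 'a) metric \<Rightarrow> bool" where
  "riemannian_metric A g \<longleftrightarrow>
     (\<forall>p. bilinear (g p) \<and> (\<forall>v w. g p v w = g p w v) \<and> (\<forall>v. v \<noteq> 0 \<longrightarrow> g p v v > 0)) \<and>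
     (\<forall>X Y. smooth_vf A X \<and> smooth_vf A Y \<longrightarrow> smooth_map A (\<lambda>p. g p (X p) (Y p)))"

definition grad :: "('p, 'a::euclidean_space) atlas \<Rightarrow> ('p, 'a) metric \<Rightarrow> ('p \<Rightarrow> real) \<Rightarrow> 'p \<Rightarrow> 'a" where
  "grad A g \<phi> p = (THE u. \<forall>v. g p u v = differential A \<phi> p v)"

text \<open>
  The torsion-freeness \<open>\<nabla>\<^sub>X Y - \<nabla>\<^sub>Y X = [X, Y]\<close> is expressed by the action of both sides on smooth
  functions \<open>h\<close>, with \<open>[X, Y] h = X (Y h) - Y (X h)\<close>.
\<close>

definition is_levi_civita ::
  "('p, 'a::euclidean_space) atlas \<Rightarrow> ('p, 'a) metric \<Rightarrow> (('p \<Rightarrow> 'a) \<Rightarrow> ('p \<Rightarrow> 'a) \<Rightarrow> 'p \<Rightarrow> 'a) \<Rightarrow> bool" where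
  "is_levi_civita A g nab \<longleftrightarrow>
     (\<forall>X Y. smooth_vf A X \<and> smooth_vf A Y \<longrightarrow> smooth_vf A (nab X Y)) \<and>
     (\<forall>X X' Y. smooth_vf A X \<and> smooth_vf A X' \<and> smooth_vf A Y \<longrightarrow>
        (\<forall>p. nab (\<lambda>q. X q + X' q) Y p = nab X Y p + nab X' Y p)) \<and>
     (\<forall>X Y Y'. smooth_vf A X \<and> smooth_vf A Y \<and> smooth_vf A Y' \<longrightarrow>
        (\<forall>p. nab X (\<lambda>q. Y q + Y' q) p = nab X Y p + nab X Y' p)) \<and>
     (\<forall>h X Y. smooth_map A h \<and> smooth_vf A X \<and> smooth_vf A Y \<longrightarrow>
        (\<forall>p. nab (\<lambda>q. h q *\<^sub>R X q) Y p = h p *\<^sub>R nab X Y p)) \<and>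
     (\<forall>h X Y. smooth_map A h \<and> smooth_vf A X \<and> smooth_vf A Y \<longrightarrow>
        (\<forall>p. nab X (\<lambda>q. h q *\<^sub>R Y q) p = differential A h p (X p) *\<^sub>R Y p + h p *\<^sub>R nab X Y p)) \<and>
     (\<forall>X Y h. smooth_vf A X \<and> smooth_vf A Y \<and> smooth_map A h \<longrightarrow>
        (\<forall>p. differential A (h :: 'p \<Rightarrow> real) p (nab X Y p - nab Y X p) =
              differential A (\<lambda>q. differential A h q (Y q)) p (X p) -
              differential A (\<lambda>q. differential A h q (X q)) p (Y p))) \<and>
     (\<forall>X Y Z. smooth_vf A X \<and> smooth_vf A Y \<and> smooth_vf A Z \<longrightarrow>
        (\<forall>p. differential A (\<lambda>q. g q (Y q) (Z q)) p (X p) =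
              g p (nab X Y p) (Z p) + g p (Y p) (nab X Z p)))"

text \<open>
  The choice only affects arguments that are not smooth: on smooth vector fields the Levi-Civita
  connection exists and is unique.
\<close>

definition levi_civita ::
  "('p, 'a::euclidean_space) atlas \<Rightarrow> ('p, 'a) metric \<Rightarrow> ('p \<Rightarrow> 'a) \<Rightarrow> ('p \<Rightarrow> 'a) \<Rightarrow> 'p \<Rightarrow> 'a" where
  "levi_civita A g = (SOME nab. is_levi_civita A g nab)"

section \<open>Distributions\<close>

definition subbundle :: "('p::topological_space, 'a::euclidean_space) atlas \<Rightarrow> ('p \<Rightarrow> 'a set) \<Rightarrow> bool" where
  "subbundle A E \<longleftrightarrow>
     (\<exists>r. (\<forall>p. subspace (E p) \<and> dim (E p) = r) \<and>
          (\<forall>p. \<exists>U e. open U \<and> p \<in> U \<and> (\<forall>i<r. smooth_vf_on A U (e i)) \<and>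
                 (\<forall>q\<in>U. E q = span ((\<lambda>i::nat. e i q) ` {..<r}))))"

definition sections :: "('p, 'a::euclidean_space) atlas \<Rightarrow> ('p \<Rightarrow> 'a set) \<Rightarrow> ('p \<Rightarrow> 'a) set" where
  "sections A E = {X. smooth_vf A X \<and> (\<forall>p. X p \<in> E p)}"

definition perp :: "('p, 'a) metric \<Rightarrow> ('p \<Rightarrow> 'a set) \<Rightarrow> 'p \<Rightarrow> 'a set" where
  "perp g E p = {w. \<forall>v\<in>E p. g p v w = 0}"

definition perp_part :: "('p, 'a::ab_group_add) metric \<Rightarrow> ('p \<Rightarrow> 'a set) \<Rightarrow> 'p \<Rightarrow> 'a \<Rightarrow> 'a" where
  "perp_part g E p w = (THE u. u \<in> perp g E p \<and> w - u \<in> E p)"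

definition umbilical_with ::
  "('p::topological_space, 'a::euclidean_space) atlas \<Rightarrow> ('p, 'a) metric \<Rightarrow> ('p \<Rightarrow> 'a set) \<Rightarrow> ('p \<Rightarrow> 'a) \<Rightarrow> bool" where
  "umbilical_with A g E Z \<longleftrightarrow>
     subbundle A E \<and> Z \<in> sections A (perp g E) \<and>
     (\<forall>T\<in>sections A E. \<forall>S\<in>sections A E. \<forall>p.
        perp_part g E p (levi_civita A g T S p) = g p (T p) (S p) *\<^sub>R Z p)"

definition spherical ::
  "('p::topological_space, 'a::euclidean_space) atlas \<Rightarrow> ('p, 'a) metric \<Rightarrow> ('p \<Rightarrow> 'a set) \<Rightarrow> bool" where
  "spherical A g E \<longleftrightarrow>
     (\<exists>Z. umbilical_with A g E Z \<and>
          (\<forall>T\<in>sections A E. \<forall>p. perp_part g E p (levi_civita A g T Z p) = 0))"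

text \<open>
  The product net of \<open>M\<^sub>0 \<times> M\<^sub>1\<close>: by the choice of \<^const>\<open>prod_atlas\<close>, the tangent space at \<open>(p, q)\<close>
  is the product of the tangent spaces at \<open>p\<close> and \<open>q\<close>.
\<close>

definition net0 :: "'p \<times> 'q \<Rightarrow> ('a::real_vector \<times> 'b::real_vector) set" where
  "net0 _ = UNIV \<times> {0}"

definition net1 :: "'p \<times> 'q \<Rightarrow> ('a::real_vector \<times> 'b::real_vector) set" where
  "net1 _ = {0} \<times> UNIV"

definition orthogonal_net :: "('p, 'a) metric \<Rightarrow> ('p \<Rightarrow> 'a set) \<Rightarrow> ('p \<Rightarrow> 'a set) \<Rightarrow> bool" where
  "orthogonal_net g E F \<longleftrightarrow> (\<forall>p. \<forall>v\<in>E p. \<forall>w\<in>F p. g p v w = 0)"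

section \<open>Immersions into Euclidean space\<close>

definition immersion :: "('p, 'a::euclidean_space) atlas \<Rightarrow> ('p \<Rightarrow> 'e::euclidean_space) \<Rightarrow> bool" where
  "immersion A h \<longleftrightarrow> smooth_map A h \<and> (\<forall>p. inj (differential A h p))"

definition induced_metric ::
  "('p, 'a::euclidean_space) atlas \<Rightarrow> ('p \<Rightarrow> 'e::euclidean_space) \<Rightarrow> ('p, 'a) metric" where
  "induced_metric A h p v w = differential A h p v \<bullet> differential A h p w"

definition isometric_immersion ::
  "('p, 'a::euclidean_space) atlas \<Rightarrow> ('p, 'a) metric \<Rightarrow> ('p \<Rightarrow> 'e::euclidean_space) \<Rightarrow> bool" where
  "isometric_immersion A g h \<longleftrightarrow> immersion A h \<and> (\<forall>p v w. g p v w = induced_metric A h p v w)"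

definition substantial :: "('p \<Rightarrow> 'e::euclidean_space) \<Rightarrow> bool" where
  "substantial h \<longleftrightarrow> affine hull (range h) = UNIV"

definition normal_space ::
  "('p, 'a::euclidean_space) atlas \<Rightarrow> ('p \<Rightarrow> 'e::euclidean_space) \<Rightarrow> 'p \<Rightarrow> 'e set" where
  "normal_space A h p = (range (differential A h p))\<^sup>\<bottom>"

definition normal_part ::
  "('p, 'a::euclidean_space) atlas \<Rightarrow> ('p \<Rightarrow> 'e::euclidean_space) \<Rightarrow> 'p \<Rightarrow> 'e \<Rightarrow> 'e" where
  "normal_part A h p w = (THE n. n \<in> normal_space A h p \<and> w - n \<in> range (differential A h p))"

definition normal_field ::
  "('p, 'a::euclidean_space) atlas \<Rightarrow> ('p \<Rightarrow> 'e::euclidean_space) \<Rightarrow> ('p \<Rightarrow> 'e) \<Rightarrow> bool" where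
  "normal_field A h \<beta> \<longleftrightarrow> smooth_map A \<beta> \<and> (\<forall>p. \<beta> p \<in> normal_space A h p)"

definition normal_connection ::
  "('p, 'a::euclidean_space) atlas \<Rightarrow> ('p \<Rightarrow> 'e::euclidean_space) \<Rightarrow> ('p \<Rightarrow> 'a) \<Rightarrow> ('p \<Rightarrow> 'e) \<Rightarrow> 'p \<Rightarrow> 'e" where
  "normal_connection A h X \<beta> p = normal_part A h p (differential A \<beta> p (X p))"

text \<open>\<open>\<alpha>\<^sup>h(X, Y)\<close> is the normal component of the Euclidean derivative of \<open>h\<^sub>* Y\<close> in the direction \<open>X\<close>.\<close>

definition second_ff ::
  "('p, 'a::euclidean_space) atlas \<Rightarrow> ('p \<Rightarrow> 'e::euclidean_space) \<Rightarrow> ('p \<Rightarrow> 'a) \<Rightarrow> ('p \<Rightarrow> 'a) \<Rightarrow> 'p \<Rightarrow> 'e" where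
  "second_ff A h X Y p =
     normal_part A h p (differential A (\<lambda>q. differential A h q (Y q)) p (X p))"

definition adapted ::
  "('p, 'a::euclidean_space) atlas \<Rightarrow> ('p \<Rightarrow> 'e::euclidean_space) \<Rightarrow> ('p \<Rightarrow> 'a set) \<Rightarrow> ('p \<Rightarrow> 'a set) \<Rightarrow> bool" where
  "adapted A h E F \<longleftrightarrow>
     (\<forall>X\<in>sections A E. \<forall>Y\<in>sections A F. \<forall>p. second_ff A h X Y p = 0)"

definition D_set ::
  "('p, 'a::euclidean_space) atlas \<Rightarrow> ('p, 'a) metric \<Rightarrow> ('p \<Rightarrow> 'e::euclidean_space) \<Rightarrow>
   (('p \<Rightarrow> real) \<times> ('p \<Rightarrow> 'e)) set" where
  "D_set A g h = {(\<phi>, \<beta>). smooth_map A \<phi> \<and> normal_field A h \<beta> \<and>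
     (\<forall>X. smooth_vf A X \<longrightarrow>
        (\<forall>p. second_ff A h (grad A g \<phi>) X p + normal_connection A h X \<beta> p = 0))}"

section \<open>Ribaucour partial tubes\<close>

definition parallel_orthonormal_frame ::
  "('p, 'a::euclidean_space) atlas \<Rightarrow> ('p \<Rightarrow> 'e::euclidean_space) \<Rightarrow> ('k \<Rightarrow> 'p \<Rightarrow> 'e) \<Rightarrow> bool" where
  "parallel_orthonormal_frame A h \<xi> \<longleftrightarrow>
     (\<forall>i. normal_field A h (\<xi> i) \<and>
          (\<forall>X. smooth_vf A X \<longrightarrow> (\<forall>p. normal_connection A h X (\<xi> i) p = 0))) \<and>
     (\<forall>i j p. \<xi> i p \<bullet> \<xi> j p = (if i = j then 1 else 0))"

text \<open>The isometry \<open>\<Psi>\<close> is determined by the frame \<open>\<xi>\<close>.\<close>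

definition Psi :: "('k::finite \<Rightarrow> 'q \<Rightarrow> 'e::euclidean_space) \<Rightarrow> 'q \<Rightarrow> real ^ 'k \<Rightarrow> 'e" where
  "Psi \<xi> x1 y = (\<Sum>i\<in>UNIV. y $ i *\<^sub>R \<xi> i x1)"

definition ribaucour_F ::
  "('q, 'b::euclidean_space) atlas \<Rightarrow> ('q, 'b) metric \<Rightarrow> ('p \<Rightarrow> real ^ 'k::finite) \<Rightarrow> ('q \<Rightarrow> 'e::euclidean_space) \<Rightarrow>
   ('k \<Rightarrow> 'q \<Rightarrow> 'e) \<Rightarrow> ('q \<Rightarrow> real) \<Rightarrow> ('q \<Rightarrow> 'e) \<Rightarrow> 'p \<Rightarrow> 'q \<Rightarrow> 'e" where
  "ribaucour_F A1 g1 f0 f1 \<xi> \<phi> \<beta> x0 x1 =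
     differential A1 f1 x1 (grad A1 g1 \<phi> x1) + \<beta> x1 + Psi \<xi> x1 (f0 x0)"

definition ribaucour_map ::
  "('q, 'b::euclidean_space) atlas \<Rightarrow> ('q, 'b) metric \<Rightarrow> ('p \<Rightarrow> real ^ 'k::finite) \<Rightarrow> ('q \<Rightarrow> 'e::euclidean_space) \<Rightarrow>
   ('k \<Rightarrow> 'q \<Rightarrow> 'e) \<Rightarrow> ('q \<Rightarrow> real) \<Rightarrow> ('q \<Rightarrow> 'e) \<Rightarrow> 'p \<times> 'q \<Rightarrow> 'e" where
  "ribaucour_map A1 g1 f0 f1 \<xi> \<phi> \<beta> = (\<lambda>(x0, x1).
     let F = ribaucour_F A1 g1 f0 f1 \<xi> \<phi> \<beta> x0 x1; \<nu> = inverse ((norm F)\<^sup>2)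
     in f1 x1 - (2 * \<nu> * \<phi> x1) *\<^sub>R F)"

text \<open>
  The function \<open>\<nu>\<close>, and hence the map, is only defined where \<open>\<F>\<close> does not vanish; as
  \<open>inverse 0 = 0\<close> here, the non-vanishing has to be required explicitly.
\<close>

definition ribaucour_partial_tube ::
  "('p, 'a::euclidean_space) atlas \<Rightarrow> ('p, 'a) metric \<Rightarrow> ('q, 'b::euclidean_space) atlas \<Rightarrow> ('q, 'b) metric \<Rightarrow>
   ('p \<Rightarrow> real ^ 'k::finite) \<Rightarrow> ('q \<Rightarrow> 'e::euclidean_space) \<Rightarrow> ('k \<Rightarrow> 'q \<Rightarrow> 'e) \<Rightarrow> ('q \<Rightarrow> real) \<Rightarrow> ('q \<Rightarrow> 'e) \<Rightarrow>
   ('p \<times> 'q \<Rightarrow> 'e) \<Rightarrow> bool" where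
  "ribaucour_partial_tube A0 g0 A1 g1 f0 f1 \<xi> \<phi> \<beta> f \<longleftrightarrow>
     isometric_immersion A1 g1 f1 \<and> parallel_orthonormal_frame A1 f1 \<xi> \<and>
     isometric_immersion A0 g0 f0 \<and> substantial f0 \<and>
     (\<phi>, \<beta>) \<in> D_set A1 g1 f1 \<and>
     (\<forall>x0 x1. ribaucour_F A1 g1 f0 f1 \<xi> \<phi> \<beta> x0 x1 \<noteq> 0) \<and>
     f = ribaucour_map A1 g1 f0 f1 \<xi> \<phi> \<beta> \<and>
     immersion (prod_atlas A0 A1) f"

end

theory Submission
  imports Defs
begin

text \<open>
  Let \<open>R\<close> be the reflection in the hyperplane orthogonal to \<open>\<F>\<close>. Since \<open>(\<phi>, \<beta>)\<close> is in \<open>\<D>(f\<^sub>1)\<close> and the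
  \<open>\<xi>\<^sub>i\<close> are parallel, the derivative of \<open>\<F>\<close> along \<open>M\<^sub>1\<close> is tangent to \<open>f\<^sub>1\<close>, while its derivative along
  \<open>M\<^sub>0\<close> lies in \<open>\<L>\<close>. Differentiating \<open>f = f\<^sub>1 - 2 \<nu> \<phi> \<F>\<close> gives \<open>f\<^sub>* T M\<^sub>1 = R (f\<^sub>1\<^sub>* T M\<^sub>1)\<close> and
  \<open>f\<^sub>* T = - 2 \<nu> \<phi> R (\<Psi> f\<^sub>0\<^sub>* T)\<close> for \<open>T\<close> tangent to \<open>M\<^sub>0\<close>, hence orthogonality. For \<open>w\<close> tangent to \<open>f\<^sub>1\<close> at a
  fixed point of \<open>M\<^sub>1\<close>, the derivative of \<open>R w\<close> along \<open>T\<close> is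
  \<open>R (\<partial>\<^sub>T w) + \<phi>\<^sup>-\<^sup>1 \<langle>w, f\<^sub>1\<^sub>* grad \<phi>\<rangle> f\<^sub>* T\<close>, which is tangent to \<open>f\<close>; so the second fundamental form is
  adapted. The same formula shows that the mean curvature vector field of \<open>E\<^sub>0\<close> is \<open>Z\<close> with
  \<open>f\<^sub>* Z = R (- \<phi>\<^sup>-\<^sup>1 f\<^sub>1\<^sub>* grad \<phi>)\<close>, and, the argument of \<open>R\<close> being constant along \<open>M\<^sub>0\<close>, that \<open>\<partial>\<^sub>T (f\<^sub>* Z)\<close> is a
  multiple of \<open>f\<^sub>* T\<close>.

  The Levi-Civita connection of an induced metric is the tangential part of the Euclidean derivative.
\<close>

section \<open>Calculus of smooth functions\<close>

lemma frechet_derivative_apply: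
  "(f has_derivative f') (at x) \<Longrightarrow> frechet_derivative f (at x) v = f' v"
  using frechet_derivative_at by metis

text \<open>Openness of \<open>S\<close> turns equality on \<open>S\<close> into equality near each
  of its points, so the derivatives agree on \<open>S\<close> too and the induction passes to
  them.\<close>

lemma Ck_on_cong:
  assumes "open S" "\<And>x. x \<in> S \<Longrightarrow> f x = g x" "Ck_on n S f"
  shows "Ck_on n S g"
  using assms(2,3)
proof (induction n arbitrary: f g)
  case 0
  then show ?case by (simp cong: continuous_on_cong)
next
  case (Suc n)
  have d: "(g has_derivative frechet_derivative f (at x)) (at x)" if "x \<in> S" for x
    using Suc.prems that assms(1)
    by (auto intro!: has_derivative_transform_within_open[of f _ x UNIV S g] simp: frechet_derivative_works)
  then have e: "frechet_derivative f (at x) v = frechet_derivative g (at x) v" if "x \<in> S" for x v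
    using frechet_derivative_at that by metis
  have "Ck_on n S (\<lambda>x. frechet_derivative g (at x) v)" for v
    by (rule Suc.IH[of "\<lambda>x. frechet_derivative f (at x) v"]) (use Suc.prems e in auto)
  then show ?case using d by (auto simp: differentiable_def)
qed

text \<open>Lets the derivative be given by an explicit formula in place of
  \<open>frechet_derivative\<close>; the two agree by uniqueness of derivatives.\<close>

lemma Ck_on_SucI:
  assumes "open S" "\<And>x. x \<in> S \<Longrightarrow> (f has_derivative f' x) (at x)" "\<And>v. Ck_on n S (\<lambda>x. f' x v)"
  shows "Ck_on (Suc n) S f"
proof -
  have e: "f' x v = frechet_derivative f (at x) v" if "x \<in> S" for x v
    using frechet_derivative_at assms(2) that by metis
  have "Ck_on n S (\<lambda>x. frechet_derivative f (at x) v)" for v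
    by (rule Ck_on_cong[OF assms(1) e[of _ v] assms(3)])
  then show ?thesis using assms(2) by (auto simp: differentiable_def)
qed

lemma Ck_on_SucD: "Ck_on (Suc n) S f \<Longrightarrow> Ck_on n S f"
proof (induction n arbitrary: f)
  case 0
  then show ?case
    by (auto intro!: continuous_at_imp_continuous_on differentiable_imp_continuous_within)
qed auto

lemma Ck_on_has_derivative:
  "Ck_on (Suc n) S f \<Longrightarrow> x \<in> S \<Longrightarrow> (f has_derivative frechet_derivative f (at x)) (at x)"
  by (auto simp: frechet_derivative_works)

lemma Ck_on_const: "Ck_on n S (\<lambda>x. c)"
  by (induction n arbitrary: c) auto

lemma Ck_on_add:
  assumes "open S" "Ck_on n S f" "Ck_on n S g"
  shows "Ck_on n S (\<lambda>x. f x + g x)"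
  using assms(2,3)
proof (induction n arbitrary: f g)
  case (Suc n)
  show ?case
    by (rule Ck_on_SucI[OF assms(1) has_derivative_add[OF Ck_on_has_derivative Ck_on_has_derivative]])
       (use Suc in auto)
qed (auto intro: continuous_on_add)

lemma Ck_on_sum:
  assumes "open S" "\<And>i. i \<in> I \<Longrightarrow> Ck_on n S (f i)"
  shows "Ck_on n S (\<lambda>x. \<Sum>i\<in>I. f i x)"
  using assms(2)
  by (induction I rule: infinite_finite_induct) (auto simp: Ck_on_const intro: Ck_on_add[OF assms(1)])

lemma (in bounded_linear) Ck_on_linear:
  assumes "open S" "Ck_on n S g"
  shows "Ck_on n S (\<lambda>x. f (g x))"
  using assms(2)
proof (induction n arbitrary: g)
  case (Suc n)
  show ?case
    by (rule Ck_on_SucI[OF assms(1) has_derivative[OF Ck_on_has_derivative]])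
       (use Suc in auto)
qed (auto intro: continuous_on)

lemma (in bounded_bilinear) Ck_on_bilinear:
  assumes "open S" "Ck_on n S f" "Ck_on n S g"
  shows "Ck_on n S (\<lambda>x. prod (f x) (g x))"
  using assms(2,3)
proof (induction n arbitrary: f g)
  case (Suc n)
  \<comment> \<open>The product rule also contains the undifferentiated factors, which enter the
    induction with order \<open>n\<close>.\<close>
  note fg = Suc.prems[THEN Ck_on_SucD]
  show ?case
    by (rule Ck_on_SucI[OF assms(1) FDERIV[OF Ck_on_has_derivative Ck_on_has_derivative]])
       (use Suc fg in \<open>auto intro!: Ck_on_add[OF assms(1)]\<close>)
qed (auto intro: continuous_on)

lemma linear_euclidean_sum:
  fixes L :: "'a::euclidean_space \<Rightarrow> 'b::real_vector"
  assumes "linear L"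
  shows "L v = (\<Sum>b\<in>Basis. (v \<bullet> b) *\<^sub>R L b)"
proof -
  have "L v = L (\<Sum>b\<in>Basis. (v \<bullet> b) *\<^sub>R b)" by (simp add: euclidean_representation)
  then show ?thesis by (simp add: linear_sum[OF assms] linear_scale[OF assms])
qed

text \<open>Regularity of \<open>J\<close> is given only on fixed vectors. Expanding
  \<open>u x\<close> in the basis reduces the claim to finitely many products of a coordinate of
  \<open>u\<close> with some \<open>J x b\<close>.\<close>

lemma Ck_on_linear_apply:
  fixes J :: "'x::real_normed_vector \<Rightarrow> 'a::euclidean_space \<Rightarrow> 'b::real_normed_vector"
  assumes "open S" "\<And>x. x \<in> S \<Longrightarrow> linear (J x)" "\<And>v. Ck_on n S (\<lambda>x. J x v)" "Ck_on n S u"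
  shows "Ck_on n S (\<lambda>x. J x (u x))"
proof (rule Ck_on_cong[OF assms(1)])
  show "Ck_on n S (\<lambda>x. \<Sum>b\<in>Basis. (u x \<bullet> b) *\<^sub>R J x b)"
    by (intro Ck_on_sum[OF assms(1)] bounded_bilinear.Ck_on_bilinear[OF bounded_bilinear_scaleR assms(1)] assms(3)
        bounded_linear.Ck_on_linear[OF bounded_linear_inner_left assms(1)] assms(4))
qed (simp add: linear_euclidean_sum[OF assms(2), symmetric])

text \<open>The chain rule gives a linear map depending on \<open>x\<close>, applied to a vector
  depending on \<open>x\<close>, which is the situation of \<open>Ck_on_linear_apply\<close>. The
  induction varies \<open>f\<close> and keeps \<open>g\<close> fixed.\<close>

lemma Ck_on_compose:
  fixes g :: "'x::real_normed_vector \<Rightarrow> 'a::euclidean_space"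
  assumes "open S" "Ck_on n T f" "Ck_on n S g" "g ` S \<subseteq> T"
  shows "Ck_on n S (\<lambda>x. f (g x))"
  using assms(2,3)
proof (induction n arbitrary: f)
  case 0
  then show ?case using assms(4) by (auto intro: continuous_on_compose2)
next
  case (Suc n)
  show ?case
  proof (rule Ck_on_SucI[OF assms(1)])
    fix x assume x: "x \<in> S"
    then show "((\<lambda>x. f (g x)) has_derivative
        (\<lambda>v. frechet_derivative f (at (g x)) (frechet_derivative g (at x) v))) (at x)"
      by (intro has_derivative_compose[where f=g, OF Ck_on_has_derivative Ck_on_has_derivative])
        (use assms(4) Suc.prems in blast)+
  next
    fix v
    show "Ck_on n S (\<lambda>x. frechet_derivative f (at (g x)) (frechet_derivative g (at x) v))"
    proof (rule Ck_on_linear_apply[OF assms(1), where J="\<lambda>x. frechet_derivative f (at (g x))"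
          and u="\<lambda>x. frechet_derivative g (at x) v"])
      fix x assume "x \<in> S"
      then have "f differentiable (at (g x))" using assms(4) Suc.prems(1) by auto
      then show "linear (frechet_derivative f (at (g x)))" by (rule linear_frechet_derivative)
    next
      fix v show "Ck_on n S (\<lambda>x. frechet_derivative f (at (g x)) v)"
        by (rule Suc.IH[OF _ Ck_on_SucD[OF Suc.prems(2)]]) (use Suc.prems(1) in simp)
    next
      show "Ck_on n S (\<lambda>x. frechet_derivative g (at x) v)" using Suc.prems(2) by simp
    qed
  qed
qed

text \<open>
  Smoothness of a solution \<open>u\<close> of \<open>J(x) u(x) = w(x)\<close> with injective \<open>J\<close>: once \<open>u\<close> is differentiable,
  \<open>\<partial>u\<close> solves an equation with the same \<open>J\<close> and the right-hand side \<open>\<partial>w - (\<partial>J) u\<close>.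
\<close>

lemma injective_solution_continuous:
  fixes J :: "'x::real_normed_vector \<Rightarrow> 'a::euclidean_space \<Rightarrow> 'b::euclidean_space"
  assumes "open S" "\<And>x. x \<in> S \<Longrightarrow> linear (J x)" "\<And>x. x \<in> S \<Longrightarrow> inj (J x)"
    "\<And>v. continuous_on S (\<lambda>x. J x v)" "\<And>x. x \<in> S \<Longrightarrow> J x (u x) = w x" "x0 \<in> S"
  obtains L E where "bounded_linear L" "L \<circ> J x0 = id" "(E \<longlongrightarrow> 0) (at x0)"
    "\<And>x. x \<in> S \<Longrightarrow> norm ((u x - u x0) - L (w x - J x (u x0))) \<le> E x * norm (u x - u x0)"
proof -
  obtain L where L: "linear L" "L \<circ> J x0 = id"
    using linear_injective_left_inverse assms by blast
  \<comment> \<open>\<open>E x\<close> bounds the operator norm of \<open>L \<circ> J x - id\<close>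
    and tends to 0 because \<open>L\<close> is a left inverse of \<open>J x0\<close>.\<close>
  define E where "E x = (\<Sum>b\<in>Basis. norm (L (J x b) - b))" for x
  have bl: "bounded_linear L" using L(1) linear_conv_bounded_linear by blast
  have lim: "((\<lambda>x. norm (L (J x b) - b)) \<longlongrightarrow> norm (L (J x0 b) - b)) (at x0)" for b
    by (intro tendsto_intros bounded_linear.tendsto[OF bl])
       (use assms(4,6) in \<open>simp add: continuous_on_eq_continuous_at[OF assms(1)] isCont_def\<close>)
  have "L (J x0 b) = b" for b using L(2) by (metis comp_apply id_apply)
  then have "((\<lambda>x. norm (L (J x b) - b)) \<longlongrightarrow> 0) (at x0)" for b using lim[of b] by simp
  then have E0: "(E \<longlongrightarrow> 0) (at x0)" unfolding E_def by (rule tendsto_null_sum)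
  have "norm ((u x - u x0) - L (w x - J x (u x0))) \<le> E x * norm (u x - u x0)" if "x \<in> S" for x
  proof -
    define d where "d = u x - u x0"
    have lin: "linear (\<lambda>v. v - L (J x v))"
      using linear_compose_sub[OF linear_ident linear_compose[OF assms(2)[OF that] L(1)]] by (simp add: o_def)
    have "w x - J x (u x0) = J x d"
      using assms(5)[OF that] by (simp add: d_def linear_diff[OF assms(2)[OF that]])
    then have "d - L (w x - J x (u x0)) = (\<Sum>b\<in>Basis. (d \<bullet> b) *\<^sub>R (b - L (J x b)))"
      using linear_euclidean_sum[OF lin, of d] by simp
    also have "norm \<dots> \<le> (\<Sum>b\<in>Basis. norm (L (J x b) - b) * norm d)"
      by (rule sum_norm_le) (auto simp: norm_minus_commute mult.commute intro!: mult_left_mono mult_right_mono Basis_le_norm)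
    finally show ?thesis by (simp add: E_def d_def sum_distrib_right)
  qed
  then show thesis using that bl L(2) E0 by blast
qed

text \<open>Near \<open>x0\<close> the factor \<open>E\<close> is below 1/2, so the error term is
  absorbed on the left: the increment of \<open>u\<close> is at most twice the norm of
  \<open>L (w x - J x (u x0))\<close>, which tends to 0.\<close>

lemma injective_solution_isCont:
  fixes J :: "'x::real_normed_vector \<Rightarrow> 'a::euclidean_space \<Rightarrow> 'b::euclidean_space"
  assumes "open S" "\<And>x. x \<in> S \<Longrightarrow> linear (J x)" "\<And>x. x \<in> S \<Longrightarrow> inj (J x)"
    "\<And>v. continuous_on S (\<lambda>x. J x v)" "\<And>x. x \<in> S \<Longrightarrow> J x (u x) = w x" "x0 \<in> S"
    "continuous_on S w"
  shows "isCont u x0"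
proof -
  obtain L E where L: "bounded_linear L" "L \<circ> J x0 = id" and E: "(E \<longlongrightarrow> 0) (at x0)"
    "\<And>x. x \<in> S \<Longrightarrow> norm ((u x - u x0) - L (w x - J x (u x0))) \<le> E x * norm (u x - u x0)"
    by (rule injective_solution_continuous[OF assms(1-6)]) auto
  have inS: "\<forall>\<^sub>F x in at x0. x \<in> S" using assms(1,6) by (auto simp: eventually_at_topological)
  have half: "\<forall>\<^sub>F x in at x0. E x < 1/2" using E(1) by (rule order_tendstoD(2)) simp
  have "((\<lambda>x. 2 * norm (L (w x - J x (u x0)))) \<longlongrightarrow> 2 * norm (L (w x0 - J x0 (u x0)))) (at x0)"
    by (intro tendsto_intros bounded_linear.tendsto[OF L(1)])
       (use assms(4,6,7) in \<open>simp_all add: continuous_on_eq_continuous_at[OF assms(1)] isCont_def\<close>)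
  then have lim: "((\<lambda>x. 2 * norm (L (w x - J x (u x0)))) \<longlongrightarrow> 0) (at x0)"
    using assms(5,6) linear_0[OF bounded_linear.linear[OF L(1)]] by simp
  have "\<forall>\<^sub>F x in at x0. norm (u x - u x0) \<le> 2 * norm (L (w x - J x (u x0)))"
    using inS half
  proof eventually_elim
    case (elim x)
    have "norm (u x - u x0) \<le> norm ((u x - u x0) - L (w x - J x (u x0))) + norm (L (w x - J x (u x0)))"
      using norm_triangle_ineq[of "u x - u x0 - L (w x - J x (u x0))" "L (w x - J x (u x0))"] by simp
    moreover have "E x * norm (u x - u x0) \<le> 1/2 * norm (u x - u x0)"
      using elim by (intro mult_right_mono) auto
    ultimately show ?case using E(2)[OF elim(1)] by linarith
  qed
  then have "((\<lambda>x. u x - u x0) \<longlongrightarrow> 0) (at x0)"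
    using lim by (rule Lim_null_comparison)
  then show ?thesis unfolding isCont_def using LIM_zero_iff by blast
qed

text \<open>With \<open>u x0\<close> frozen, \<open>r x = L (w x - J x (u x0))\<close> is
  differentiable. Its derivative serves for \<open>u\<close>, because the increment of
  \<open>u\<close> is at most linear in \<open>x - x0\<close> and differs from \<open>r x\<close> by
  at most \<open>E x\<close> times itself.\<close>

lemma injective_solution_differentiable:
  fixes J :: "'x::real_normed_vector \<Rightarrow> 'a::euclidean_space \<Rightarrow> 'b::euclidean_space"
  assumes "open S" "\<And>x. x \<in> S \<Longrightarrow> linear (J x)" "\<And>x. x \<in> S \<Longrightarrow> inj (J x)"
    "\<And>v x. x \<in> S \<Longrightarrow> (\<lambda>x. J x v) differentiable (at x)"
    "\<And>x. x \<in> S \<Longrightarrow> J x (u x) = w x" "x0 \<in> S"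
    "\<And>x. x \<in> S \<Longrightarrow> w differentiable (at x)"
  shows "u differentiable (at x0)"
proof -
  have cont: "continuous_on S (\<lambda>x. J x v)" "continuous_on S w" for v
    using assms(4,7) by (auto intro!: continuous_at_imp_continuous_on differentiable_imp_continuous_within)
  obtain L E where L: "bounded_linear L" "L \<circ> J x0 = id" and E: "(E \<longlongrightarrow> 0) (at x0)"
    "\<And>x. x \<in> S \<Longrightarrow> norm ((u x - u x0) - L (w x - J x (u x0))) \<le> E x * norm (u x - u x0)"
    using injective_solution_continuous[where J=J and S=S and u=u and w=w and ?x0.0=x0]
      assms(1-3,5,6) cont(1) by metis
  have inS: "\<forall>\<^sub>F x in at x0. x \<in> S" using assms(1,6) by (auto simp: eventually_at_topological)
  define r where "r x = L (w x - J x (u x0))" for x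
  have "r differentiable (at x0)"
    unfolding r_def
    by (intro differentiable_compose[OF bounded_linear_imp_differentiable[OF L(1)]] derivative_intros assms)
  then obtain r' where r': "(r has_derivative r') (at x0)" by (auto simp: differentiable_def)
  have r0: "r x0 = 0" using assms(5,6) linear_0[OF bounded_linear.linear[OF L(1)]] by (simp add: r_def)
  obtain B where B: "\<And>h. norm (r' h) \<le> norm h * B"
    using bounded_linear.bounded[OF has_derivative_bounded_linear[OF r']] by blast
  have R: "((\<lambda>x. norm (r x - r x0 - r' (x - x0)) / norm (x - x0)) \<longlongrightarrow> 0) (at x0)"
    using r' by (simp add: has_derivative_iff_norm)
  have half: "\<forall>\<^sub>F x in at x0. \<bar>E x\<bar> < 1/2"
    using tendsto_rabs[OF E(1)] by (rule order_tendstoD(2)) simp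
  have ne: "\<forall>\<^sub>F x in at x0. x \<noteq> x0" by (simp add: eventually_at_filter)
  \<comment> \<open>The remainder quotient in the differentiability of \<open>r\<close> at
    \<open>x0\<close>, which tends to 0.\<close>
  define q where "q x = norm (r x - r x0 - r' (x - x0)) / norm (x - x0)" for x
  have bound: "\<forall>\<^sub>F x in at x0. norm (norm (u x - u x0 - r' (x - x0)) / norm (x - x0))
      \<le> q x + \<bar>E x\<bar> * (2 * (q x + B))"
    using inS half ne
  proof eventually_elim
    case (elim x)
    let ?n = "norm (x - x0)" and ?d = "norm (u x - u x0)"
    have n: "?n > 0" using elim by simp
    have e1: "norm (u x - u x0 - r x) \<le> \<bar>E x\<bar> * ?d"
      using E(2)[OF elim(1)] mult_right_mono[OF abs_ge_self[of "E x"], of ?d, OF norm_ge_zero] unfolding r_def by linarith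
    have e2: "norm (r x - r' (x - x0)) = q x * ?n" using n r0 by (simp add: q_def)
    \<comment> \<open>Absorbing half of the increment of \<open>u\<close> as in the proof of
      continuity leaves a bound linear in \<open>norm (x - x0)\<close>.\<close>
    have "?d \<le> norm (u x - u x0 - r x) + (norm (r x - r' (x - x0)) + norm (r' (x - x0)))"
      using norm_triangle_ineq[of "u x - u x0 - r x" "r x"]
        norm_triangle_ineq[of "r x - r' (x - x0)" "r' (x - x0)"] by simp
    moreover have "\<bar>E x\<bar> * ?d \<le> 1/2 * ?d" using elim by (intro mult_right_mono) auto
    ultimately have d: "?d \<le> 2 * (q x + B) * ?n" using e1 e2 B[of "x - x0"] by (simp add: algebra_simps)
    have "norm (u x - u x0 - r' (x - x0)) \<le> norm (u x - u x0 - r x) + norm (r x - r' (x - x0))"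
      using norm_triangle_ineq[of "u x - u x0 - r x" "r x - r' (x - x0)"] by simp
    also have "\<dots> \<le> \<bar>E x\<bar> * (2 * (q x + B) * ?n) + q x * ?n"
      using e1 e2 mult_left_mono[OF d, of "\<bar>E x\<bar>"] by linarith
    finally show ?case using n by (simp add: divide_le_eq algebra_simps)
  qed
  have "((\<lambda>x. q x + \<bar>E x\<bar> * (2 * (q x + B))) \<longlongrightarrow> 0 + \<bar>0\<bar> * (2 * (0 + B))) (at x0)"
    using R E(1) unfolding q_def[symmetric] by (intro tendsto_intros)
  then have "((\<lambda>x. q x + \<bar>E x\<bar> * (2 * (q x + B))) \<longlongrightarrow> 0) (at x0)" by simp
  from Lim_null_comparison[OF bound this]
  have "((\<lambda>x. norm (u x - u x0 - r' (x - x0)) / norm (x - x0)) \<longlongrightarrow> 0) (at x0)" .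
  then have "(u has_derivative r') (at x0)"
    using has_derivative_bounded_linear[OF r'] by (simp add: has_derivative_iff_norm)
  then show ?thesis by (auto simp: differentiable_def)
qed

lemma Ck_on_injective_solution:
  fixes J :: "'x::real_normed_vector \<Rightarrow> 'a::euclidean_space \<Rightarrow> 'b::euclidean_space"
  assumes "open S" "\<And>x. x \<in> S \<Longrightarrow> linear (J x)" "\<And>x. x \<in> S \<Longrightarrow> inj (J x)"
    "\<And>v. Ck_on n S (\<lambda>x. J x v)" "Ck_on n S w" "\<And>x. x \<in> S \<Longrightarrow> J x (u x) = w x"
  shows "Ck_on n S u"
  using assms(4-6)
proof (induction n arbitrary: u w)
  case 0
  then show ?case
    using injective_solution_isCont[where J=J and S=S, OF assms(1-3)] by (auto intro: continuous_at_imp_continuous_on)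
next
  case (Suc n)
  have u: "u differentiable (at x)" if "x \<in> S" for x
    using injective_solution_differentiable[where J=J and S=S and w=w and u=u, OF assms(1-3)] Suc.prems that by auto
  let ?J' = "\<lambda>v x a. frechet_derivative (\<lambda>x. J x a) (at x) v"
  have J': "((\<lambda>x. J x a) has_derivative (\<lambda>v. ?J' v x a)) (at x)" if "x \<in> S" for x a
    using Ck_on_has_derivative Suc.prems(1) that by fast
  have IH: "Ck_on n S u"
    using Suc.IH[of w u] Suc.prems(1,2)[THEN Ck_on_SucD] Suc.prems(3) by auto
  \<comment> \<open>The equation is differentiated with \<open>u x\<close> expanded in the basis,
    because the derivative of \<open>J\<close> is available on fixed vectors only.\<close>
  have eq: "J x (frechet_derivative u (at x) v)
      = frechet_derivative w (at x) v - (\<Sum>b\<in>Basis. (u x \<bullet> b) *\<^sub>R ?J' v x b)" if x: "x \<in> S" for x v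
  proof -
    have 1: "((\<lambda>x. (u x \<bullet> b) *\<^sub>R J x b) has_derivative
        (\<lambda>v. (u x \<bullet> b) *\<^sub>R ?J' v x b + (frechet_derivative u (at x) v \<bullet> b) *\<^sub>R J x b)) (at x)" for b
      using u[OF x] J'[OF x] by (auto intro!: derivative_eq_intros simp: frechet_derivative_works)
    have "((\<lambda>x. \<Sum>b\<in>Basis. (u x \<bullet> b) *\<^sub>R J x b) has_derivative
       (\<lambda>v. \<Sum>b\<in>Basis. (u x \<bullet> b) *\<^sub>R ?J' v x b + (frechet_derivative u (at x) v \<bullet> b) *\<^sub>R J x b)) (at x)"
      using 1 by (auto intro: has_derivative_sum)
    then have "(w has_derivative
       (\<lambda>v. \<Sum>b\<in>Basis. (u x \<bullet> b) *\<^sub>R ?J' v x b + (frechet_derivative u (at x) v \<bullet> b) *\<^sub>R J x b)) (at x)"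
      by (rule has_derivative_transform_within_open[OF _ assms(1) x])
         (metis Suc.prems(3) linear_euclidean_sum[OF assms(2)])
    then have "frechet_derivative w (at x) v
       = (\<Sum>b\<in>Basis. (u x \<bullet> b) *\<^sub>R ?J' v x b + (frechet_derivative u (at x) v \<bullet> b) *\<^sub>R J x b)"
      by (rule frechet_derivative_apply)
    then show ?thesis
      by (simp add: sum.distrib linear_euclidean_sum[OF assms(2)[OF x], of "frechet_derivative u (at x) v"])
  qed
  have "Ck_on n S (\<lambda>x. frechet_derivative u (at x) v)" for v
  proof (rule Suc.IH[of "\<lambda>x. frechet_derivative w (at x) v + - (\<Sum>b\<in>Basis. (u x \<bullet> b) *\<^sub>R ?J' v x b)"])
    show "Ck_on n S (\<lambda>x. frechet_derivative w (at x) v + - (\<Sum>b\<in>Basis. (u x \<bullet> b) *\<^sub>R ?J' v x b))"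
      using Suc.prems(1,2)
      by (intro Ck_on_add Ck_on_sum assms(1) IH
          bounded_linear.Ck_on_linear[OF bounded_linear_minus[OF bounded_linear_ident]]
          bounded_bilinear.Ck_on_bilinear[OF bounded_bilinear_scaleR assms(1)]
          bounded_linear.Ck_on_linear[OF bounded_linear_inner_left assms(1)]) auto
  qed (use eq Suc.prems(1)[THEN Ck_on_SucD] in auto)
  then show ?case using u by simp
qed

section \<open>Rules for smooth functions on open sets\<close>

lemma smooth_on_cong:
  "open S \<Longrightarrow> (\<And>x. x \<in> S \<Longrightarrow> f x = g x) \<Longrightarrow> smooth_on S f \<Longrightarrow> smooth_on S g"
  unfolding smooth_on_def using Ck_on_cong[where f=f and g=g] by blast

lemma smooth_on_deriv: "smooth_on S f \<Longrightarrow> smooth_on S (\<lambda>x. frechet_derivative f (at x) v)"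
  unfolding smooth_on_def using Ck_on.simps(2) by blast

lemma smooth_on_differentiable: "smooth_on S f \<Longrightarrow> x \<in> S \<Longrightarrow> f differentiable (at x)"
  unfolding smooth_on_def using Ck_on.simps(2) by blast

lemma smooth_on_has_derivative:
  "smooth_on S f \<Longrightarrow> x \<in> S \<Longrightarrow> (f has_derivative frechet_derivative f (at x)) (at x)"
  using smooth_on_differentiable frechet_derivative_works by blast

lemma smooth_on_continuous_on: "smooth_on S f \<Longrightarrow> continuous_on S f"
  unfolding smooth_on_def using Ck_on.simps(1) by blast

lemma smooth_on_const: "smooth_on S (\<lambda>x. c)"
  unfolding smooth_on_def using Ck_on_const by blast

lemma smooth_on_add: "open S \<Longrightarrow> smooth_on S f \<Longrightarrow> smooth_on S g \<Longrightarrow> smooth_on S (\<lambda>x. f x + g x)"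
  unfolding smooth_on_def using Ck_on_add[where f=f and g=g] by blast

lemma smooth_on_sum:
  "open S \<Longrightarrow> (\<And>i. i \<in> I \<Longrightarrow> smooth_on S (f i)) \<Longrightarrow> smooth_on S (\<lambda>x. \<Sum>i\<in>I. f i x)"
  unfolding smooth_on_def by (intro allI Ck_on_sum) auto

lemma smooth_on_linear: "bounded_linear L \<Longrightarrow> open S \<Longrightarrow> smooth_on S f \<Longrightarrow> smooth_on S (\<lambda>x. L (f x))"
  unfolding smooth_on_def using bounded_linear.Ck_on_linear[where f=L and g=f] by blast

lemma smooth_on_id: "open S \<Longrightarrow> smooth_on S (\<lambda>x. x)"
proof -
  assume S: "open S"
  have "Ck_on n S (\<lambda>x::'a. x)" for n
  proof (cases n)
    case (Suc m)
    then show ?thesis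
      using Ck_on_SucI[OF S has_derivative_ident Ck_on_const] by blast
  qed (auto intro: continuous_on_id)
  then show ?thesis by (simp add: smooth_on_def)
qed

lemma smooth_on_bilinear:
  "bounded_bilinear B \<Longrightarrow> open S \<Longrightarrow> smooth_on S f \<Longrightarrow> smooth_on S g \<Longrightarrow> smooth_on S (\<lambda>x. B (f x) (g x))"
  unfolding smooth_on_def using bounded_bilinear.Ck_on_bilinear[where prod=B and f=f and g=g] by blast

lemma smooth_on_compose:
  fixes g :: "'x::real_normed_vector \<Rightarrow> 'a::euclidean_space"
  shows "open S \<Longrightarrow> smooth_on T f \<Longrightarrow> smooth_on S g \<Longrightarrow> g ` S \<subseteq> T \<Longrightarrow> smooth_on S (\<lambda>x. f (g x))"
  unfolding smooth_on_def using Ck_on_compose[where f=f and g=g] by blast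

lemma smooth_on_linear_apply:
  fixes J :: "'x::real_normed_vector \<Rightarrow> 'a::euclidean_space \<Rightarrow> 'b::real_normed_vector"
  assumes "open S" "\<And>x. x \<in> S \<Longrightarrow> linear (J x)" "\<And>v. smooth_on S (\<lambda>x. J x v)" "smooth_on S u"
  shows "smooth_on S (\<lambda>x. J x (u x))"
  unfolding smooth_on_def
proof
  fix n show "Ck_on n S (\<lambda>x. J x (u x))"
    by (rule Ck_on_linear_apply[where J=J and u=u])
       (use assms in \<open>simp_all add: smooth_on_def\<close>)
qed

lemma smooth_on_injective_solution:
  fixes J :: "'x::real_normed_vector \<Rightarrow> 'a::euclidean_space \<Rightarrow> 'b::euclidean_space"
  assumes "open S" "\<And>x. x \<in> S \<Longrightarrow> linear (J x)" "\<And>x. x \<in> S \<Longrightarrow> inj (J x)"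
    "\<And>v. smooth_on S (\<lambda>x. J x v)" "smooth_on S w" "\<And>x. x \<in> S \<Longrightarrow> J x (u x) = w x"
  shows "smooth_on S u"
  unfolding smooth_on_def
proof
  fix n show "Ck_on n S u"
    by (rule Ck_on_injective_solution[where J=J and w=w])
       (use assms in \<open>simp_all add: smooth_on_def\<close>)
qed

lemma smooth_on_deriv_apply:
  fixes f :: "'x::euclidean_space \<Rightarrow> 'b::real_normed_vector"
  assumes "open S" "smooth_on S f" "smooth_on S u"
  shows "smooth_on S (\<lambda>x. frechet_derivative f (at x) (u x))"
  by (rule smooth_on_linear_apply[OF assms(1) _ smooth_on_deriv[OF assms(2)] assms(3)])
     (rule linear_frechet_derivative[OF smooth_on_differentiable[OF assms(2)]])

section \<open>Symmetry of second derivatives\<close>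

lemma second_difference_mean_value:
  fixes f :: "'x::real_normed_vector \<Rightarrow> real"
  assumes "open S" "smooth_on S f" "h > 0"
    and sub: "\<And>s t. 0 \<le> s \<Longrightarrow> s \<le> h \<Longrightarrow> 0 \<le> t \<Longrightarrow> t \<le> h \<Longrightarrow> x + s *\<^sub>R u + t *\<^sub>R v \<in> S"
  obtains s t where "0 \<le> s" "s \<le> h" "0 \<le> t" "t \<le> h"
    "f (x + h *\<^sub>R u + h *\<^sub>R v) - f (x + h *\<^sub>R u) - f (x + h *\<^sub>R v) + f x
      = h\<^sup>2 * frechet_derivative (\<lambda>y. frechet_derivative f (at y) u) (at (x + s *\<^sub>R u + t *\<^sub>R v)) v"
proof -
  let ?D = "\<lambda>y. frechet_derivative f (at y)"
  let ?D2 = "\<lambda>y. frechet_derivative (\<lambda>y. frechet_derivative f (at y) u) (at y)"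
  have D: "(f has_derivative ?D y) (at y)" if "y \<in> S" for y
    using smooth_on_has_derivative assms(2) that by blast
  have D2: "((\<lambda>y. ?D y u) has_derivative ?D2 y) (at y)" if "y \<in> S" for y
    using smooth_on_has_derivative[OF smooth_on_deriv[OF assms(2)]] that by blast
  have lin: "linear (?D y)" "linear (?D2 y)" if "y \<in> S" for y
    using D[OF that] D2[OF that] has_derivative_linear by blast+
  \<comment> \<open>The second difference is \<open>\<phi> h - \<phi> 0\<close>. The mean value
    theorem is used twice: for \<open>\<phi>\<close> in the direction \<open>u\<close>, then for the
    resulting difference of first derivatives in the direction \<open>v\<close>.\<close>
  define \<phi> where "\<phi> s = f (x + s *\<^sub>R u + h *\<^sub>R v) - f (x + s *\<^sub>R u)" for s :: real
  have 1: "(\<phi> has_derivative (\<lambda>r. r * (?D (x + s *\<^sub>R u + h *\<^sub>R v) u - ?D (x + s *\<^sub>R u) u))) (at s within {0..h})"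
    if s: "0 \<le> s" "s \<le> h" for s
  proof -
    have i: "x + s *\<^sub>R u + h *\<^sub>R v \<in> S" "x + s *\<^sub>R u \<in> S"
      using sub[OF s, of h] sub[OF s, of 0] assms(3) by auto
    have "((\<lambda>s. f (x + s *\<^sub>R u + h *\<^sub>R v)) has_derivative (\<lambda>r. ?D (x + s *\<^sub>R u + h *\<^sub>R v) (r *\<^sub>R u))) (at s within {0..h})"
      by (rule has_derivative_compose[where f="\<lambda>s. x + s *\<^sub>R u + h *\<^sub>R v", OF _ D[OF i(1)]]) (auto intro!: derivative_eq_intros)
    moreover have "((\<lambda>s. f (x + s *\<^sub>R u)) has_derivative (\<lambda>r. ?D (x + s *\<^sub>R u) (r *\<^sub>R u))) (at s within {0..h})"
      by (rule has_derivative_compose[where f="\<lambda>s. x + s *\<^sub>R u", OF _ D[OF i(2)]]) (auto intro!: derivative_eq_intros)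
    ultimately show ?thesis
      unfolding \<phi>_def by (rule has_derivative_eq_rhs[OF has_derivative_diff])
        (simp add: linear_scale[OF lin(1)[OF i(1)]] linear_scale[OF lin(1)[OF i(2)]] right_diff_distrib)
  qed
  obtain s where s: "0 < s" "s < h" "\<phi> h - \<phi> 0 = h * (?D (x + s *\<^sub>R u + h *\<^sub>R v) u - ?D (x + s *\<^sub>R u) u)"
    using mvt_simple[OF assms(3), of \<phi> "\<lambda>s r. r * (?D (x + s *\<^sub>R u + h *\<^sub>R v) u - ?D (x + s *\<^sub>R u) u)"] 1 by auto
  have 2: "((\<lambda>t. ?D (x + s *\<^sub>R u + t *\<^sub>R v) u) has_derivative (\<lambda>r. r * ?D2 (x + s *\<^sub>R u + t *\<^sub>R v) v)) (at t within {0..h})"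
    if t: "0 \<le> t" "t \<le> h" for t
  proof -
    have i: "x + s *\<^sub>R u + t *\<^sub>R v \<in> S" using sub s t by auto
    have "((\<lambda>t. ?D (x + s *\<^sub>R u + t *\<^sub>R v) u) has_derivative (\<lambda>r. ?D2 (x + s *\<^sub>R u + t *\<^sub>R v) (r *\<^sub>R v))) (at t within {0..h})"
      by (rule has_derivative_compose[where f="\<lambda>t. x + s *\<^sub>R u + t *\<^sub>R v" and g="\<lambda>y. ?D y u", OF _ D2[OF i]]) (auto intro!: derivative_eq_intros)
    then show ?thesis by (simp add: linear_scale[OF lin(2)] i)
  qed
  obtain t where t: "0 < t" "t < h" "?D (x + s *\<^sub>R u + h *\<^sub>R v) u - ?D (x + s *\<^sub>R u) u = h * ?D2 (x + s *\<^sub>R u + t *\<^sub>R v) v"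
    using mvt_simple[OF assms(3), of "\<lambda>t. ?D (x + s *\<^sub>R u + t *\<^sub>R v) u" "\<lambda>t r. r * ?D2 (x + s *\<^sub>R u + t *\<^sub>R v) v"] 2 by auto
  show thesis
    using that[of s t] s t by (simp add: \<phi>_def power2_eq_square)
qed

text \<open>The second difference is symmetric in \<open>u\<close> and \<open>v\<close>, so the two
  mixed derivatives take equal values at points arbitrarily close to \<open>x\<close>. If they
  differed at \<open>x\<close>, continuity would keep them apart nearby.\<close>

lemma smooth_on_second_derivative_symmetric:
  fixes f :: "'x::real_normed_vector \<Rightarrow> real"
  assumes S: "open S" and f: "smooth_on S f" and x: "x \<in> S"
  shows "frechet_derivative (\<lambda>y. frechet_derivative f (at y) u) (at x) v
       = frechet_derivative (\<lambda>y. frechet_derivative f (at y) v) (at x) u"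
proof -
  let ?D2 = "\<lambda>u v y. frechet_derivative (\<lambda>y. frechet_derivative f (at y) u) (at y) v"
  obtain e where e: "e > 0" "ball x e \<subseteq> S" using S x openE by blast
  \<comment> \<open>Parallelograms spanned by multiples of \<open>u\<close> and \<open>v\<close>
    with coefficients up to \<open>d / ?c\<close> stay within distance \<open>d\<close>; the summand
    1 keeps \<open>?c\<close> positive when both vectors vanish.\<close>
  let ?c = "norm u + norm v + 1"
  have c: "?c > 0" by (smt (verit) norm_ge_zero)
  have near: "norm (s *\<^sub>R u + t *\<^sub>R v) < d" if "0 \<le> s" "s \<le> d / ?c" "0 \<le> t" "t \<le> d / ?c" "d > 0" for s t d
  proof -
    have "norm (s *\<^sub>R u + t *\<^sub>R v) \<le> s * norm u + t * norm v"
      using norm_triangle_ineq[of "s *\<^sub>R u" "t *\<^sub>R v"] that by simp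
    also have "\<dots> \<le> d / ?c * norm u + d / ?c * norm v"
      using that by (intro add_mono mult_right_mono) auto
    also have "\<dots> = d * ((norm u + norm v) / ?c)" by (simp add: add_divide_distrib distrib_left)
    also have "\<dots> < d" using that(5) c mult_strict_left_mono[of "(norm u + norm v) / ?c" 1 d] by simp
    finally show ?thesis .
  qed
  have cont: "isCont (?D2 u v) x" for u v
    using smooth_on_continuous_on[OF smooth_on_deriv[OF smooth_on_deriv[OF f]]] S x
      continuous_on_eq_continuous_at by blast
  show ?thesis
  proof (rule ccontr)
    assume "?D2 u v x \<noteq> ?D2 v u x"
    then have pos: "dist (?D2 u v x) (?D2 v u x) / 2 > 0" by simp
    obtain d1 where d1: "d1 > 0" "\<And>y. dist y x < d1 \<Longrightarrow> dist (?D2 u v y) (?D2 u v x) < dist (?D2 u v x) (?D2 v u x) / 2"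
      using cont[of u v] pos unfolding continuous_at_eps_delta by blast
    obtain d2 where d2: "d2 > 0" "\<And>y. dist y x < d2 \<Longrightarrow> dist (?D2 v u y) (?D2 v u x) < dist (?D2 u v x) (?D2 v u x) / 2"
      using cont[of v u] pos unfolding continuous_at_eps_delta by blast
    define d where "d = min e (min d1 d2)"
    have d: "d > 0" "d \<le> e" "d \<le> d1" "d \<le> d2" using e d1 d2 by (auto simp: d_def)
    define h where "h = d / ?c"
    have h: "h > 0" using d c by (simp add: h_def)
    have in_d: "dist (x + s *\<^sub>R u + t *\<^sub>R v) x < d" if "0 \<le> s" "s \<le> h" "0 \<le> t" "t \<le> h" for s t
      using near[of s d t] that d(1) by (simp add: h_def dist_norm add.assoc)
    have "x + s *\<^sub>R u + t *\<^sub>R v \<in> S" if "0 \<le> s" "s \<le> h" "0 \<le> t" "t \<le> h" for s t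
      using in_d[OF that] d(2) e(2) by (auto simp: dist_commute)
    then obtain s t where st: "0 \<le> s" "s \<le> h" "0 \<le> t" "t \<le> h"
      "f (x + h *\<^sub>R u + h *\<^sub>R v) - f (x + h *\<^sub>R u) - f (x + h *\<^sub>R v) + f x
        = h\<^sup>2 * ?D2 u v (x + s *\<^sub>R u + t *\<^sub>R v)"
      using second_difference_mean_value[OF S f h, of x u v] by metis
    have "x + s *\<^sub>R v + t *\<^sub>R u \<in> S" if "0 \<le> s" "s \<le> h" "0 \<le> t" "t \<le> h" for s t
      using in_d[OF that(3,4,1,2)] d(2) e(2) by (auto simp: dist_commute algebra_simps)
    then obtain s' t' where st': "0 \<le> s'" "s' \<le> h" "0 \<le> t'" "t' \<le> h"
      "f (x + h *\<^sub>R v + h *\<^sub>R u) - f (x + h *\<^sub>R v) - f (x + h *\<^sub>R u) + f x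
        = h\<^sup>2 * ?D2 v u (x + s' *\<^sub>R v + t' *\<^sub>R u)"
      using second_difference_mean_value[OF S f h, of x v u] by metis
    have eq: "?D2 u v (x + s *\<^sub>R u + t *\<^sub>R v) = ?D2 v u (x + s' *\<^sub>R v + t' *\<^sub>R u)"
      using st(5) st'(5) h by (simp add: algebra_simps)
    have "dist (?D2 u v (x + s *\<^sub>R u + t *\<^sub>R v)) (?D2 u v x) < dist (?D2 u v x) (?D2 v u x) / 2"
      using d1(2) in_d[OF st(1-4)] d(3) by simp
    moreover have "dist (?D2 v u (x + s' *\<^sub>R v + t' *\<^sub>R u)) (?D2 v u x) < dist (?D2 u v x) (?D2 v u x) / 2"
      using d2(2) in_d[OF st'(3,4,1,2)] d(4) by (simp add: algebra_simps)
    ultimately show False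
      using eq dist_triangle2[of "?D2 u v x" "?D2 v u x" "?D2 u v (x + s *\<^sub>R u + t *\<^sub>R v)"] by (simp add: dist_commute)
  qed
qed

section \<open>Calculus on manifolds\<close>

lemma smooth_on_second_derivative_symmetric_vector:
  fixes f :: "'x::real_normed_vector \<Rightarrow> 'e::euclidean_space"
  assumes S: "open S" and f: "smooth_on S f" and x: "x \<in> S"
  shows "frechet_derivative (\<lambda>y. frechet_derivative f (at y) u) (at x) v
       = frechet_derivative (\<lambda>y. frechet_derivative f (at y) v) (at x) u"
proof (rule euclidean_eqI)
  fix b :: 'e
  assume "b \<in> Basis"
  let ?g = "\<lambda>y. f y \<bullet> b"
  have g: "smooth_on S ?g"
    using smooth_on_linear[OF bounded_linear_inner_left S f] .
  have 1: "frechet_derivative ?g (at y) w = frechet_derivative f (at y) w \<bullet> b" if "y \<in> S" for y w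
    by (rule frechet_derivative_apply[OF has_derivative_inner_left[OF smooth_on_has_derivative[OF f that]]])
  have "frechet_derivative (\<lambda>y. frechet_derivative ?g (at y) w) (at x) w'
      = frechet_derivative (\<lambda>y. frechet_derivative f (at y) w) (at x) w' \<bullet> b" for w w'
  proof -
    have "((\<lambda>y. frechet_derivative f (at y) w \<bullet> b) has_derivative
        (\<lambda>w'. frechet_derivative (\<lambda>y. frechet_derivative f (at y) w) (at x) w' \<bullet> b)) (at x)"
      by (rule has_derivative_inner_left[OF smooth_on_has_derivative[OF smooth_on_deriv[OF f] x]])
    then have "((\<lambda>y. frechet_derivative ?g (at y) w) has_derivative
        (\<lambda>w'. frechet_derivative (\<lambda>y. frechet_derivative f (at y) w) (at x) w' \<bullet> b)) (at x)"
      by (rule has_derivative_transform_within_open[OF _ S x]) (simp add: 1)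
    then show ?thesis by (rule frechet_derivative_apply)
  qed
  then show "frechet_derivative (\<lambda>y. frechet_derivative f (at y) u) (at x) v \<bullet> b
      = frechet_derivative (\<lambda>y. frechet_derivative f (at y) v) (at x) u \<bullet> b"
    using smooth_on_second_derivative_symmetric[OF S g x, of u v] by simp
qed

text \<open>The product rule for \<open>Df(x) u(x)\<close>. Symmetry moves \<open>u x\<close> into
  the outer derivative, where linearity is known, so that the sum over the basis collapses.\<close>

lemma smooth_on_deriv_apply_has_derivative:
  fixes f :: "'x::euclidean_space \<Rightarrow> 'e::euclidean_space"
  assumes S: "open S" and f: "smooth_on S f" and u: "smooth_on S u" and x: "x \<in> S"
  shows "((\<lambda>x. frechet_derivative f (at x) (u x)) has_derivative
    (\<lambda>a. frechet_derivative (\<lambda>y. frechet_derivative f (at y) a) (at x) (u x)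
       + frechet_derivative f (at x) (frechet_derivative u (at x) a))) (at x)"
proof -
  let ?D = "\<lambda>y. frechet_derivative f (at y)"
  have lin: "linear (?D y)" if "y \<in> S" for y
    using linear_frechet_derivative smooth_on_differentiable[OF f that] by blast
  have lin2: "linear (frechet_derivative (\<lambda>y. ?D y a) (at x))" for a
    using linear_frechet_derivative smooth_on_differentiable[OF smooth_on_deriv[OF f] x] by blast
  have "((\<lambda>y. (u y \<bullet> b) *\<^sub>R ?D y b) has_derivative (\<lambda>a. (u x \<bullet> b) *\<^sub>R frechet_derivative (\<lambda>y. ?D y b) (at x) a
      + (frechet_derivative u (at x) a \<bullet> b) *\<^sub>R ?D x b)) (at x)" for b
    using has_derivative_scaleR[OF has_derivative_inner_left[OF smooth_on_has_derivative[OF u x]]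
        smooth_on_has_derivative[OF smooth_on_deriv[OF f] x], of b b] .
  then have "((\<lambda>y. \<Sum>b\<in>Basis. (u y \<bullet> b) *\<^sub>R ?D y b) has_derivative
      (\<lambda>a. \<Sum>b\<in>Basis. (u x \<bullet> b) *\<^sub>R frechet_derivative (\<lambda>y. ?D y b) (at x) a
      + (frechet_derivative u (at x) a \<bullet> b) *\<^sub>R ?D x b)) (at x)"
    by (intro has_derivative_sum)
  then have "((\<lambda>y. ?D y (u y)) has_derivative
      (\<lambda>a. \<Sum>b\<in>Basis. (u x \<bullet> b) *\<^sub>R frechet_derivative (\<lambda>y. ?D y b) (at x) a
      + (frechet_derivative u (at x) a \<bullet> b) *\<^sub>R ?D x b)) (at x)"
    by (rule has_derivative_transform_within_open[OF _ S x])
       (simp add: linear_euclidean_sum[OF lin, symmetric])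
  moreover have "(\<Sum>b\<in>Basis. (u x \<bullet> b) *\<^sub>R frechet_derivative (\<lambda>y. ?D y b) (at x) a
      + (frechet_derivative u (at x) a \<bullet> b) *\<^sub>R ?D x b)
      = frechet_derivative (\<lambda>y. ?D y a) (at x) (u x) + ?D x (frechet_derivative u (at x) a)" for a
    unfolding smooth_on_second_derivative_symmetric_vector[OF S f x, of _ a] sum.distrib
    by (simp add: linear_euclidean_sum[OF lin[OF x], symmetric] linear_euclidean_sum[OF lin2, symmetric])
  ultimately show ?thesis by simp
qed

text \<open>Unlike \<open>differential\<close>, which has a value for every function, this also
  asserts differentiability at \<open>p\<close>; hence it can be composed by calculus rules.\<close>

definition has_differential ::
  "('p, 'a::euclidean_space) atlas \<Rightarrow> ('p \<Rightarrow> 'c::real_normed_vector) \<Rightarrow> ('a \<Rightarrow> 'c) \<Rightarrow> 'p \<Rightarrow> bool" where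
  "has_differential A F L p \<longleftrightarrow> (F \<circ> icoord A p has_derivative L) (at (coord A p p))"

text \<open>The local notion is meant for open \<open>U\<close> and serves for coordinate maps,
  whose behaviour matters only on their chart domain.\<close>

definition smooth_map_on ::
  "('p, 'a::euclidean_space) atlas \<Rightarrow> 'p set \<Rightarrow> ('p \<Rightarrow> 'c::real_normed_vector) \<Rightarrow> bool" where
  "smooth_map_on A U F \<longleftrightarrow> (\<forall>q. smooth_on (coord A q ` (U \<inter> cdom A q)) (F \<circ> icoord A q))"

text \<open>The tangent vector at \<open>p\<close> whose coordinates with respect to the chart around \<open>q\<close> are \<open>a\<close>.\<close>

definition coord_vector :: "('p, 'a::euclidean_space) atlas \<Rightarrow> 'p \<Rightarrow> 'p \<Rightarrow> 'a \<Rightarrow> 'a" where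
  "coord_vector A q p a = frechet_derivative (coord A p \<circ> icoord A q) (at (coord A q p)) a"

text \<open>The coordinate expression \<open>DY X - DX Y\<close> in the chart around
  \<open>p\<close>, in which tangent vectors at \<open>p\<close> are their own coordinates.\<close>

definition lie_bracket :: "('p, 'a::euclidean_space) atlas \<Rightarrow> ('p \<Rightarrow> 'a) \<Rightarrow> ('p \<Rightarrow> 'a) \<Rightarrow> 'p \<Rightarrow> 'a" where
  "lie_bracket A X Y p =
     frechet_derivative (\<lambda>x. differential A (coord A p) (icoord A p x) (Y (icoord A p x))) (at (coord A p p)) (X p)
   - frechet_derivative (\<lambda>x. differential A (coord A p) (icoord A p x) (X (icoord A p x))) (at (coord A p p)) (Y p)"

lemma has_differential_differential:
  "has_differential A F L p \<Longrightarrow> differential A F p = L"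
  unfolding has_differential_def differential_def using frechet_derivative_at by fastforce

lemma has_differential_unique:
  "has_differential A F L p \<Longrightarrow> has_differential A F L' p \<Longrightarrow> L v = L' v"
  using has_differential_differential by metis

lemma smooth_map_on_UNIV: "smooth_map_on A UNIV F \<longleftrightarrow> smooth_map A F"
  by (simp add: smooth_map_on_def smooth_map_def)

section \<open>Charts and differentials\<close>

locale manifold =
  fixes A :: "('p::{t2_space, second_countable_topology}, 'a::euclidean_space) atlas"
  assumes manifold: "smooth_manifold A"
begin

lemma mem_cdom [simp]: "p \<in> cdom A p" and open_cdom: "open (cdom A p)"
  and open_coord_cdom: "open (coord A p ` cdom A p)"
  and homeomorphism_coord: "homeomorphism (cdom A p) (coord A p ` cdom A p) (coord A p) (icoord A p)"
  and smooth_transition: "smooth_on (coord A p ` (cdom A p \<inter> cdom A q)) (coord A q \<circ> icoord A p)"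
  using manifold unfolding smooth_manifold_def by blast+

lemma icoord_coord [simp]: "x \<in> cdom A p \<Longrightarrow> icoord A p (coord A p x) = x"
  using homeomorphism_coord homeomorphism_apply1 by metis

lemma coord_icoord [simp]: "y \<in> coord A p ` cdom A p \<Longrightarrow> coord A p (icoord A p y) = y"
  using homeomorphism_coord homeomorphism_apply2 by metis

lemma icoord_mem: "y \<in> coord A p ` cdom A p \<Longrightarrow> icoord A p y \<in> cdom A p"
  by auto

lemma coord_image_Int: "coord A p ` (U \<inter> cdom A p) = coord A p ` cdom A p \<inter> icoord A p -` U"
  by force

lemma open_coord_image: "open U \<Longrightarrow> open (coord A p ` (U \<inter> cdom A p))"
  unfolding coord_image_Int
  using homeomorphism_coord[of p] open_coord_cdom[of p]
  by (auto simp: homeomorphism_def intro: continuous_open_preimage)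

lemma transition_has_derivative:
  assumes "p \<in> cdom A q" "p \<in> cdom A r" "(F \<circ> icoord A q has_derivative L) (at (coord A q p))"
  shows "(F \<circ> icoord A r has_derivative
    (\<lambda>a. L (frechet_derivative (coord A q \<circ> icoord A r) (at (coord A r p)) a))) (at (coord A r p))"
proof -
  let ?N = "coord A r ` (cdom A q \<inter> cdom A r)"
  have N: "open ?N" "coord A r p \<in> ?N" using open_coord_image open_cdom assms by auto
  have "(coord A q \<circ> icoord A r has_derivative frechet_derivative (coord A q \<circ> icoord A r) (at (coord A r p)))
      (at (coord A r p))"
    by (rule smooth_on_has_derivative[OF smooth_transition]) (use assms in auto)
  moreover have "(F \<circ> icoord A q has_derivative L) (at ((coord A q \<circ> icoord A r) (coord A r p)))"
    using assms by simp
  ultimately have "((F \<circ> icoord A q) \<circ> (coord A q \<circ> icoord A r) has_derivative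
     L \<circ> frechet_derivative (coord A q \<circ> icoord A r) (at (coord A r p))) (at (coord A r p))"
    by (rule diff_chain_at)
  then have "(F \<circ> icoord A r has_derivative
     L \<circ> frechet_derivative (coord A q \<circ> icoord A r) (at (coord A r p))) (at (coord A r p))"
    by (rule has_derivative_transform_within_open[OF _ N]) auto
  then show ?thesis by (simp add: o_def)
qed

text \<open>Together with \<open>has_derivative_chart\<close> this translates between the chart
  attached to \<open>p\<close>, which changes from point to point, and one fixed chart containing
  \<open>p\<close>.\<close>

lemma has_differential_chart:
  assumes "p \<in> cdom A q" "(F \<circ> icoord A q has_derivative L) (at (coord A q p))"
  shows "has_differential A F (\<lambda>v. L (differential A (coord A q) p v)) p"
  using transition_has_derivative[OF assms(1) mem_cdom assms(2)]
  by (simp add: has_differential_def differential_def)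

lemma has_derivative_chart:
  assumes "p \<in> cdom A q" "has_differential A F L p"
  shows "(F \<circ> icoord A q has_derivative (\<lambda>a. L (coord_vector A q p a))) (at (coord A q p))"
  using transition_has_derivative[OF mem_cdom assms(1)] assms(2)
  by (simp add: has_differential_def coord_vector_def)

lemma smooth_map_on_has_differential:
  assumes "smooth_map_on A U F" "p \<in> U"
  shows "has_differential A F (differential A F p) p"
proof -
  have "(F \<circ> icoord A p has_derivative frechet_derivative (F \<circ> icoord A p) (at (coord A p p))) (at (coord A p p))"
    by (rule smooth_on_has_derivative[where S="coord A p ` (U \<inter> cdom A p)"])
       (use assms in \<open>auto simp: smooth_map_on_def\<close>)
  then show ?thesis unfolding has_differential_def by (simp add: differential_def[abs_def])
qed

lemma smooth_map_has_differential:
  "smooth_map A F \<Longrightarrow> has_differential A F (differential A F p) p"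
  using smooth_map_on_has_differential smooth_map_on_UNIV by blast

lemma smooth_map_on_coord: "smooth_map_on A (cdom A q) (coord A q)"
  unfolding smooth_map_on_def using smooth_transition by (simp add: Int_commute)

lemma linear_has_differential: "has_differential A F L p \<Longrightarrow> linear L"
  unfolding has_differential_def using has_derivative_linear by blast

lemma linear_differential: "smooth_map A F \<Longrightarrow> linear (differential A F p)"
  using smooth_map_has_differential linear_has_differential by blast

lemma differential_coord_vector:
  assumes "p \<in> cdom A q" "has_differential A F L p"
  shows "L (coord_vector A q p a) = frechet_derivative (F \<circ> icoord A q) (at (coord A q p)) a"
  using frechet_derivative_apply[OF has_derivative_chart[OF assms]] by simp

lemma frechet_derivative_coord_self:
  "p \<in> cdom A q \<Longrightarrow> frechet_derivative (coord A q \<circ> icoord A q) (at (coord A q p)) = (\<lambda>a. a)"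
proof -
  assume p: "p \<in> cdom A q"
  have "((\<lambda>x. x) has_derivative (\<lambda>a. a)) (at (coord A q p))" by (rule has_derivative_ident)
  then have "(coord A q \<circ> icoord A q has_derivative (\<lambda>a. a)) (at (coord A q p))"
    by (rule has_derivative_transform_within_open[OF _ open_coord_cdom[of q]]) (use p in auto)
  then show ?thesis using frechet_derivative_at by metis
qed

lemma differential_coord_coord_vector [simp]:
  assumes "p \<in> cdom A q" shows "differential A (coord A q) p (coord_vector A q p a) = a"
  using differential_coord_vector[OF assms smooth_map_on_has_differential[OF smooth_map_on_coord assms]]
  by (simp add: frechet_derivative_coord_self[OF assms])

lemma differential_coord_self [simp]: "differential A (coord A p) p v = v"
  by (simp add: differential_def frechet_derivative_coord_self)

lemma coord_vector_differential [simp]: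
  assumes "p \<in> cdom A q" shows "coord_vector A q p (differential A (coord A q) p v) = v"
proof -
  have "has_differential A (coord A p) (differential A (coord A p) p) p"
    by (rule smooth_map_on_has_differential[OF smooth_map_on_coord]) simp
  then have "has_differential A (coord A p) (\<lambda>v. differential A (coord A p) p
      (coord_vector A q p (differential A (coord A q) p v))) p"
    by (intro has_differential_chart[OF assms] has_derivative_chart assms)
  then show ?thesis
    using has_differential_differential differential_coord_self by metis
qed

lemma linear_coord_vector: "p \<in> cdom A q \<Longrightarrow> linear (coord_vector A q p)"
proof -
  assume p: "p \<in> cdom A q"
  have "(coord A p \<circ> icoord A q) differentiable (at (coord A q p))"
    by (rule smooth_on_differentiable[OF smooth_transition]) (use p in auto)
  then show ?thesis unfolding coord_vector_def[abs_def] by (rule linear_frechet_derivative)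
qed

text \<open>Expresses the differentials at all points of a chart domain, each defined through its
  own chart, by the derivative of one function, which can be differentiated again.\<close>

lemma differential_in_chart:
  assumes "p \<in> cdom A q" "smooth_map A F"
  shows "differential A F p v = frechet_derivative (F \<circ> icoord A q) (at (coord A q p)) (differential A (coord A q) p v)"
  using differential_coord_vector[OF assms(1) smooth_map_has_differential[OF assms(2)]] assms(1)
  by (metis coord_vector_differential)

lemma smooth_on_chart: "smooth_map A F \<Longrightarrow> smooth_on (coord A q ` cdom A q) (F \<circ> icoord A q)"
  by (simp add: smooth_map_def)

lemma smooth_vf_chart:
  "smooth_vf A X \<Longrightarrow>
   smooth_on (coord A q ` cdom A q) (\<lambda>x. differential A (coord A q) (icoord A q x) (X (icoord A q x)))"
  by (simp add: smooth_vf_on_def o_def)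

lemma smooth_map_differential:
  assumes "smooth_map A F" "smooth_vf A X"
  shows "smooth_map A (\<lambda>p. differential A F p (X p))"
  unfolding smooth_map_def
proof
  fix q
  have "smooth_on (coord A q ` cdom A q) (\<lambda>x. frechet_derivative (F \<circ> icoord A q) (at x)
      (differential A (coord A q) (icoord A q x) (X (icoord A q x))))"
    by (intro smooth_on_deriv_apply open_coord_cdom smooth_on_chart smooth_vf_chart assms)
  then show "smooth_on (coord A q ` cdom A q) ((\<lambda>p. differential A F p (X p)) \<circ> icoord A q)"
    by (rule smooth_on_cong[OF open_coord_cdom, rotated])
       (auto simp: differential_in_chart[OF _ assms(1), where q=q])
qed

text \<open>In the chart around \<open>p\<close> both terms split into a second derivative of
  \<open>F\<close> and \<open>DF\<close> applied to the derivative of a field. The second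
  derivatives cancel by symmetry.\<close>

lemma differential_lie_bracket:
  fixes F :: "'p \<Rightarrow> 'e::euclidean_space"
  assumes F: "smooth_map A F" and X: "smooth_vf A X" and Y: "smooth_vf A Y"
  shows "differential A (\<lambda>q. differential A F q (Y q)) p (X p)
       - differential A (\<lambda>q. differential A F q (X q)) p (Y p) = differential A F p (lie_bracket A X Y p)"
proof -
  let ?G = "F \<circ> icoord A p"
  define x where "x = coord A p p"
  have x: "x \<in> coord A p ` cdom A p" by (simp add: x_def)
  let ?L = "\<lambda>X x. differential A (coord A p) (icoord A p x) (X (icoord A p x))"
  have D: "differential A (\<lambda>q. differential A F q (Y q)) p a
      = frechet_derivative (\<lambda>y. frechet_derivative ?G (at y) a) (at x) (Y p)
       + frechet_derivative ?G (at x) (frechet_derivative (?L Y) (at x) a)" if Y: "smooth_vf A Y" for Y a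
  proof -
    have "((\<lambda>x. frechet_derivative ?G (at x) (?L Y x)) has_derivative
       (\<lambda>a. frechet_derivative (\<lambda>y. frechet_derivative ?G (at y) a) (at x) (?L Y x)
       + frechet_derivative ?G (at x) (frechet_derivative (?L Y) (at x) a))) (at x)"
      by (intro smooth_on_deriv_apply_has_derivative[OF open_coord_cdom _ _ x] smooth_on_chart smooth_vf_chart F Y)
    then have "((\<lambda>q. differential A F q (Y q)) \<circ> icoord A p has_derivative
       (\<lambda>a. frechet_derivative (\<lambda>y. frechet_derivative ?G (at y) a) (at x) (?L Y x)
       + frechet_derivative ?G (at x) (frechet_derivative (?L Y) (at x) a))) (at x)"
      by (rule has_derivative_transform_within_open[OF _ open_coord_cdom x])
         (auto simp: differential_in_chart[OF _ F, where q=p])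
    moreover have "?L Y x = Y p" by (simp add: x_def)
    ultimately have "has_differential A (\<lambda>q. differential A F q (Y q))
       (\<lambda>a. frechet_derivative (\<lambda>y. frechet_derivative ?G (at y) a) (at x) (Y p)
       + frechet_derivative ?G (at x) (frechet_derivative (?L Y) (at x) a)) p"
      by (simp add: has_differential_def x_def)
    from has_differential_differential[OF this] show ?thesis by simp
  qed
  have lin: "linear (frechet_derivative ?G (at x))"
    using linear_frechet_derivative smooth_on_differentiable[OF smooth_on_chart[OF F] x] by blast
  show ?thesis
    unfolding D[OF X] D[OF Y] lie_bracket_def x_def[symmetric] differential_def[of A F p]
      linear_diff[OF lin]
    using smooth_on_second_derivative_symmetric_vector[OF open_coord_cdom smooth_on_chart[OF F] x, of "X p" "Y p"]
    by (simp add: algebra_simps)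
qed

section \<open>Rules for smooth maps and differentials on a manifold\<close>

lemma smooth_map_const: "smooth_map A (\<lambda>p. c)"
  by (simp add: smooth_map_def o_def smooth_on_const)

lemma smooth_map_add: "smooth_map A F \<Longrightarrow> smooth_map A G \<Longrightarrow> smooth_map A (\<lambda>p. F p + G p)"
  by (auto simp: smooth_map_def o_def intro!: smooth_on_add open_coord_cdom)

lemma smooth_map_bilinear:
  "bounded_bilinear B \<Longrightarrow> smooth_map A F \<Longrightarrow> smooth_map A G \<Longrightarrow> smooth_map A (\<lambda>p. B (F p) (G p))"
  by (auto simp: smooth_map_def o_def intro!: smooth_on_bilinear[where B=B] open_coord_cdom)

lemma smooth_map_linear: "bounded_linear L \<Longrightarrow> smooth_map A F \<Longrightarrow> smooth_map A (\<lambda>p. L (F p))"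
  by (auto simp: smooth_map_def o_def intro!: smooth_on_linear[where L=L] open_coord_cdom)

lemma smooth_map_sum: "(\<And>i. i \<in> I \<Longrightarrow> smooth_map A (F i)) \<Longrightarrow> smooth_map A (\<lambda>p. \<Sum>i\<in>I. F i p)"
  by (auto simp: smooth_map_def o_def intro!: smooth_on_sum open_coord_cdom)

lemma smooth_map_diff: "smooth_map A F \<Longrightarrow> smooth_map A G \<Longrightarrow> smooth_map A (\<lambda>p. F p - G p)"
  using smooth_map_add[OF _ smooth_map_linear[OF bounded_linear_minus[OF bounded_linear_ident]]] by force

lemma smooth_map_scaleR:
  "smooth_map A F \<Longrightarrow> smooth_map A G \<Longrightarrow> smooth_map A (\<lambda>p. F p *\<^sub>R G p)"
  using smooth_map_bilinear[OF bounded_bilinear_scaleR] .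

lemma smooth_map_inner:
  fixes F G :: "'p \<Rightarrow> 'e::euclidean_space"
  shows "smooth_map A F \<Longrightarrow> smooth_map A G \<Longrightarrow> smooth_map A (\<lambda>p. F p \<bullet> G p)"
  using smooth_map_bilinear[OF bounded_bilinear_inner] .

text \<open>The quotient solves a linear equation whose operator, multiplication by
  \<open>r p\<close>, is injective and smooth in \<open>p\<close>; so smoothness follows from
  \<open>smooth_on_injective_solution\<close>.\<close>

lemma smooth_map_divide:
  fixes F :: "'p \<Rightarrow> 'e::euclidean_space"
  assumes "smooth_map A F" "smooth_map A r" "\<And>p. r p \<noteq> 0"
  shows "smooth_map A (\<lambda>p. F p /\<^sub>R r p)"
  unfolding smooth_map_def
proof
  fix q
  show "smooth_on (coord A q ` cdom A q) ((\<lambda>p. F p /\<^sub>R r p) \<circ> icoord A q)"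
  proof (rule smooth_on_injective_solution[where J="\<lambda>x v. r (icoord A q x) *\<^sub>R v", OF open_coord_cdom])
    show "smooth_on (coord A q ` cdom A q) (F \<circ> icoord A q)" using smooth_on_chart assms(1) by blast
    show "smooth_on (coord A q ` cdom A q) (\<lambda>x. r (icoord A q x) *\<^sub>R v)" for v
      using smooth_on_chart[OF smooth_map_scaleR[OF assms(2) smooth_map_const], of q v] by (simp add: o_def)
  qed (use assms(3) in \<open>auto simp: inj_on_def linear_iff algebra_simps\<close>)
qed

lemma has_differential_bilinear:
  assumes "bounded_bilinear B" "has_differential A F F' p" "has_differential A G G' p"
  shows "has_differential A (\<lambda>q. B (F q) (G q)) (\<lambda>v. B (F p) (G' v) + B (F' v) (G p)) p"
  using bounded_bilinear.FDERIV[OF assms(1) assms(2,3)[unfolded has_differential_def o_def]]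
  by (simp add: has_differential_def o_def)

lemma has_differential_add:
  assumes "has_differential A F F' p" "has_differential A G G' p"
  shows "has_differential A (\<lambda>q. F q + G q) (\<lambda>v. F' v + G' v) p"
  using has_derivative_add[OF assms[unfolded has_differential_def o_def]]
  by (simp add: has_differential_def o_def)

lemma has_differential_linear:
  assumes "bounded_linear T" "has_differential A F F' p"
  shows "has_differential A (\<lambda>q. T (F q)) (\<lambda>v. T (F' v)) p"
  using bounded_linear.has_derivative[OF assms(1) assms(2)[unfolded has_differential_def o_def]]
  by (simp add: has_differential_def o_def)

lemma has_differential_const: "has_differential A (\<lambda>q. c) (\<lambda>v. 0) p"
  by (simp add: has_differential_def o_def)

lemma has_differential_sum:
  assumes "\<And>i. i \<in> I \<Longrightarrow> has_differential A (F i) (F' i) p"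
  shows "has_differential A (\<lambda>q. \<Sum>i\<in>I. F i q) (\<lambda>v. \<Sum>i\<in>I. F' i v) p"
  using assms has_derivative_sum[of I "\<lambda>i x. F i (icoord A p x)" F' "at (coord A p p)"]
  by (simp add: has_differential_def o_def)

text \<open>The inner product of \<open>F\<close> with any vector orthogonal to \<open>S\<close> is
  constantly 0, so the derivative is orthogonal to the complement of \<open>S\<close> and thus lies
  in \<open>S\<close>.\<close>

lemma has_differential_in_subspace:
  fixes F :: "'p \<Rightarrow> 'e::euclidean_space"
  assumes "has_differential A F F' p" "subspace S" "\<And>q. F q \<in> S"
  shows "F' v \<in> S"
proof -
  have "F' v \<bullet> n = 0" if n: "n \<in> S\<^sup>\<bottom>" for n
  proof -
    have "has_differential A (\<lambda>q. F q \<bullet> n) (\<lambda>v. F' v \<bullet> n) p"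
      by (rule has_differential_linear[OF bounded_linear_inner_left assms(1)])
    moreover have "(\<lambda>q. F q \<bullet> n) = (\<lambda>q. 0)"
      using assms(3) n by (auto simp: orthogonal_comp_def orthogonal_def)
    ultimately have "(\<lambda>v. F' v \<bullet> n) = (\<lambda>v. 0)"
      using has_differential_differential has_differential_const by metis
    then show ?thesis by metis
  qed
  then have "F' v \<in> S\<^sup>\<bottom>\<^sup>\<bottom>"
    by (auto simp: orthogonal_comp_def orthogonal_def inner_commute)
  then show ?thesis using orthogonal_comp_self[OF assms(2)] by simp
qed

end

section \<open>Immersions\<close>

text \<open>\<open>D\<^sup>T D\<close> for a linear map \<open>D\<close>.\<close>

definition gram :: "('a::euclidean_space \<Rightarrow> 'e::real_inner) \<Rightarrow> 'a \<Rightarrow> 'a" where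
  "gram D a = (\<Sum>b\<in>Basis. (D a \<bullet> D b) *\<^sub>R b)"

lemma inner_gram:
  assumes "linear D"
  shows "gram D a \<bullet> v = D a \<bullet> D v"
proof -
  have "D a \<bullet> D v = (\<Sum>b\<in>Basis. (v \<bullet> b) * (D a \<bullet> D b))"
    using linear_euclidean_sum[OF assms, of v] by (simp add: inner_sum_right)
  also have "\<dots> = gram D a \<bullet> v"
    unfolding gram_def inner_sum_left inner_scaleR_left by (rule sum.cong) (auto simp: inner_commute)
  finally show ?thesis by simp
qed

lemma linear_gram: "linear D \<Longrightarrow> linear (gram D)"
  by (auto simp: gram_def linear_iff inner_add_left scaleR_add_left sum.distrib scaleR_sum_right)

lemma inj_gram:
  assumes "linear D" "inj D"
  shows "inj (gram D)"
proof (rule linear_injective_0[OF linear_gram[OF assms(1)], THEN iffD2], intro allI impI)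
  fix a assume "gram D a = 0"
  then have "D a \<bullet> D a = 0" using inner_gram[OF assms(1), of a a] by simp
  then show "a = 0" using assms by (simp add: linear_injective_0)
qed

text \<open>The value is the tangent vector in the model space, not its image: for an immersion it
  is the preimage of the orthogonal projection of \<open>w\<close> to the tangent space.\<close>

definition tangent_part ::
  "('p, 'a::euclidean_space) atlas \<Rightarrow> ('p \<Rightarrow> 'e::euclidean_space) \<Rightarrow> 'p \<Rightarrow> 'e \<Rightarrow> 'a" where
  "tangent_part A h p w = inv (differential A h p) (w - normal_part A h p w)"

section \<open>Normal and tangential parts along an immersion\<close>

locale immersed = manifold A
  for A :: "('p::{t2_space, second_countable_topology}, 'a::euclidean_space) atlas" +
  fixes h :: "'p \<Rightarrow> 'e::euclidean_space"
  assumes immersion: "immersion A h"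
begin

abbreviation "dh \<equiv> differential A h"

lemma smooth_h: "smooth_map A h" and inj_dh: "inj (dh p)"
  using immersion by (auto simp: immersion_def)

lemma linear_dh: "linear (dh p)"
  using linear_differential[OF smooth_h] .

lemmas dh_simps = linear_add[OF linear_dh] linear_diff[OF linear_dh] linear_scale[OF linear_dh] linear_0[OF linear_dh]

lemma subspace_range_dh: "subspace (range (dh p))"
  by (simp add: linear_subspace_image[OF linear_dh])

lemma normal_space_inner: "n \<in> normal_space A h p \<Longrightarrow> n \<bullet> dh p v = 0"
  by (auto simp: normal_space_def orthogonal_comp_def orthogonal_def inner_commute)

lemma normal_spaceI: "(\<And>v. n \<bullet> dh p v = 0) \<Longrightarrow> n \<in> normal_space A h p"
  by (auto simp: normal_space_def orthogonal_comp_def orthogonal_def inner_commute)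

text \<open>Two candidates differ by a vector that is both normal and tangent, hence zero; this
  makes the definite description in \<open>normal_part\<close> usable.\<close>

lemma normal_part_eqI:
  assumes "n \<in> normal_space A h p" "w - n \<in> range (dh p)"
  shows "normal_part A h p w = n"
  unfolding normal_part_def
proof (rule the_equality)
  fix n' assume n': "n' \<in> normal_space A h p \<and> w - n' \<in> range (dh p)"
  obtain u u' where u: "w - n = dh p u" "w - n' = dh p u'" using assms n' by auto
  have "n' - n = dh p (u - u')" using u by (simp add: dh_simps algebra_simps flip: u)
  moreover have "(n' - n) \<bullet> dh p (u - u') = 0"
    using normal_space_inner assms(1) n' by (auto simp: inner_diff_left)
  ultimately show "n' = n" by simp
qed (use assms in blast)

lemma normal_part_works:
  "normal_part A h p w \<in> normal_space A h p" "w - normal_part A h p w \<in> range (dh p)"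
proof -
  obtain y z where yz: "y \<in> span (range (dh p))" "\<And>x. x \<in> span (range (dh p)) \<Longrightarrow> orthogonal z x" "w = y + z"
    using orthogonal_subspace_decomp_exists by blast
  have "z \<in> normal_space A h p"
    using yz(2) by (intro normal_spaceI) (auto simp: orthogonal_def span_base)
  moreover have "w - z \<in> range (dh p)"
    using yz(1,3) span_eq_iff[THEN iffD2, OF subspace_range_dh] by simp
  ultimately show "normal_part A h p w \<in> normal_space A h p" "w - normal_part A h p w \<in> range (dh p)"
    using normal_part_eqI by auto
qed

lemma normal_part_eq_0_iff: "normal_part A h p w = 0 \<longleftrightarrow> w \<in> range (dh p)"
proof
  assume "normal_part A h p w = 0"
  then show "w \<in> range (dh p)" using normal_part_works(2)[where w=w and p=p] by simp
next
  assume "w \<in> range (dh p)"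
  then show "normal_part A h p w = 0" by (intro normal_part_eqI normal_spaceI) auto
qed

lemma normal_part_add: "normal_part A h p (w + w') = normal_part A h p w + normal_part A h p w'"
proof (rule normal_part_eqI)
  show "normal_part A h p w + normal_part A h p w' \<in> normal_space A h p"
    by (rule normal_spaceI) (simp add: inner_add_left normal_space_inner[OF normal_part_works(1)])
  show "w + w' - (normal_part A h p w + normal_part A h p w') \<in> range (dh p)"
    using subspace_add[OF subspace_range_dh normal_part_works(2) normal_part_works(2)]
    by (simp add: algebra_simps)
qed

lemma dh_tangent_part: "dh p (tangent_part A h p w) = w - normal_part A h p w"
  unfolding tangent_part_def using normal_part_works(2) f_inv_into_f by metis

lemma inner_tangent_part [simp]: "dh p (tangent_part A h p w) \<bullet> dh p v = w \<bullet> dh p v"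
  by (simp add: dh_tangent_part inner_diff_left normal_space_inner[OF normal_part_works(1)])

text \<open>Nondegeneracy of the induced metric: testing with \<open>u - u'\<close> shows that
  \<open>dh p (u - u')\<close> has length zero, and \<open>dh p\<close> is injective.\<close>

lemma tangent_vector_eqI:
  assumes "\<And>v. dh p u \<bullet> dh p v = dh p u' \<bullet> dh p v"
  shows "u = u'"
proof -
  have "dh p (u - u') \<bullet> dh p (u - u') = 0"
    using assms[of "u - u'"] by (simp add: dh_simps inner_diff_left)
  then show ?thesis using inj_dh by (simp add: dh_simps inj_eq)
qed

lemma tangent_part_eqI: "(\<And>v. dh p u \<bullet> dh p v = w \<bullet> dh p v) \<Longrightarrow> tangent_part A h p w = u"
  by (rule tangent_vector_eqI[of p]) simp

lemma tangent_part_dh [simp]: "tangent_part A h p (dh p u) = u"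
  by (rule tangent_part_eqI) simp

lemma linear_tangent_part: "linear (tangent_part A h p)"
  by (rule linearI) (auto intro!: tangent_part_eqI simp: dh_simps inner_add_left)

section \<open>Vector fields determined by their inner products; gradients\<close>

lemma induced_metric_gram:
  "\<exists>u. \<forall>v. dh p u \<bullet> dh p v = c \<bullet> v"
proof -
  \<comment> \<open>The Gram operator is an injective endomorphism of a finite-dimensional space,
    hence onto; this yields the Riesz representation of linear forms.\<close>
  have "surj (gram (dh p))"
    using linear_injective_imp_surjective[OF linear_gram inj_gram] linear_dh inj_dh by blast
  then obtain u where "gram (dh p) u = c" by (metis surjD)
  then show ?thesis using inner_gram[OF linear_dh] by metis
qed

text \<open>In a chart, the field representing a one-form \<open>\<omega>\<close> solves a linear
  equation with the Gram operator, which is smooth and injective, and with a right-hand side formed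
  from the smooth components of \<open>\<omega>\<close>. This covers tangent parts and gradients
  alike.\<close>

lemma smooth_vf_solution:
  assumes \<omega>: "\<And>q a. smooth_on (coord A q ` cdom A q) (\<lambda>x. \<omega> (icoord A q x) (coord_vector A q (icoord A q x) a))"
    and X: "\<And>p v. dh p (X p) \<bullet> dh p v = \<omega> p v"
  shows "smooth_vf A X"
  unfolding smooth_vf_on_def
proof
  fix q
  let ?S = "coord A q ` cdom A q"
  let ?D = "\<lambda>x. frechet_derivative (h \<circ> icoord A q) (at x)"
  let ?u = "\<lambda>x. differential A (coord A q) (icoord A q x) (X (icoord A q x))"
  have D: "?D x a = dh (icoord A q x) (coord_vector A q (icoord A q x) a)" if "x \<in> ?S" for x a
    using differential_coord_vector[OF icoord_mem[OF that] smooth_map_has_differential[OF smooth_h], of a] that by simp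
  have lin: "linear (?D x)" if "x \<in> ?S" for x
    by (rule linear_frechet_derivative[OF smooth_on_differentiable[OF smooth_on_chart[OF smooth_h] that]])
  have inj: "inj (?D x)" if "x \<in> ?S" for x
  proof (rule injI)
    fix a b assume "?D x a = ?D x b"
    then have "coord_vector A q (icoord A q x) a = coord_vector A q (icoord A q x) b"
      using D[OF that] inj_dh by (simp add: inj_eq)
    then show "a = b" using differential_coord_coord_vector[OF icoord_mem[OF that]] by metis
  qed
  have "smooth_on ?S ?u"
  proof (rule smooth_on_injective_solution[where J="\<lambda>x. gram (?D x)" and
        w="\<lambda>x. \<Sum>b\<in>Basis. \<omega> (icoord A q x) (coord_vector A q (icoord A q x) b) *\<^sub>R b", OF open_coord_cdom])
    show "linear (gram (?D x))" "inj (gram (?D x))" if "x \<in> ?S" for x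
      using linear_gram[OF lin[OF that]] inj_gram[OF lin[OF that] inj[OF that]] by blast+
    have D2: "smooth_on ?S (\<lambda>x. ?D x v)" for v
      by (rule smooth_on_deriv[OF smooth_on_chart[OF smooth_h]])
    show "smooth_on ?S (\<lambda>x. gram (?D x) v)" for v
      unfolding gram_def
      by (rule smooth_on_sum[OF open_coord_cdom],
          rule smooth_on_bilinear[OF bounded_bilinear_scaleR open_coord_cdom _ smooth_on_const],
          rule smooth_on_bilinear[OF bounded_bilinear_inner open_coord_cdom D2 D2])
    show "smooth_on ?S (\<lambda>x. \<Sum>b\<in>Basis. \<omega> (icoord A q x) (coord_vector A q (icoord A q x) b) *\<^sub>R b)"
      by (rule smooth_on_sum[OF open_coord_cdom],
          rule smooth_on_bilinear[OF bounded_bilinear_scaleR open_coord_cdom \<omega> smooth_on_const])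
    show "gram (?D x) (?u x) = (\<Sum>b\<in>Basis. \<omega> (icoord A q x) (coord_vector A q (icoord A q x) b) *\<^sub>R b)"
      if "x \<in> ?S" for x
      unfolding gram_def D[OF that] coord_vector_differential[OF icoord_mem[OF that]] X ..
  qed
  then show "smooth_on (coord A q ` (UNIV \<inter> cdom A q)) ((\<lambda>p. differential A (coord A q) p (X p)) \<circ> icoord A q)"
    by (simp add: o_def)
qed

lemma smooth_vf_tangent_part:
  assumes "smooth_map A W"
  shows "smooth_vf A (\<lambda>p. tangent_part A h p (W p))"
proof (rule smooth_vf_solution[where \<omega>="\<lambda>p v. W p \<bullet> dh p v"])
  fix q a
  have "smooth_on (coord A q ` cdom A q)
      (\<lambda>x. (W \<circ> icoord A q) x \<bullet> frechet_derivative (h \<circ> icoord A q) (at x) a)"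
    by (rule smooth_on_bilinear[OF bounded_bilinear_inner open_coord_cdom
          smooth_on_chart[OF assms] smooth_on_deriv[OF smooth_on_chart[OF smooth_h]]])
  then show "smooth_on (coord A q ` cdom A q)
      (\<lambda>x. W (icoord A q x) \<bullet> dh (icoord A q x) (coord_vector A q (icoord A q x) a))"
    by (rule smooth_on_cong[OF open_coord_cdom, rotated])
       (auto simp: differential_coord_vector[OF _ smooth_map_has_differential[OF smooth_h], where q=q])
qed simp

lemma smooth_vf_lift:
  assumes "smooth_map A (\<lambda>p. dh p (X p))"
  shows "smooth_vf A X"
  using smooth_vf_tangent_part[OF assms] by simp

text \<open>The tangent part of the constant vector \<open>dh p v\<close> is a global smooth field
  with value \<open>v\<close> at \<open>p\<close>. It allows conditions on vector fields to be
  tested on single vectors.\<close>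

lemma smooth_vf_extension:
  obtains X where "smooth_vf A X" "X p = v"
  using smooth_vf_tangent_part[OF smooth_map_const, of "dh p v"] tangent_part_dh by blast

lemma smooth_map_dh: "smooth_vf A X \<Longrightarrow> smooth_map A (\<lambda>p. dh p (X p))"
  using smooth_map_differential[OF smooth_h] .

lemma smooth_vf_diff:
  assumes "smooth_vf A X" "smooth_vf A Y"
  shows "smooth_vf A (\<lambda>p. X p - Y p)"
  by (rule smooth_vf_lift) (simp add: dh_simps smooth_map_diff smooth_map_dh assms)

lemma grad_works:
  assumes g: "\<And>p v w. g p v w = induced_metric A h p v w" and \<phi>: "smooth_map A \<phi>"
  shows "dh p (grad A g \<phi> p) \<bullet> dh p v = differential A \<phi> p v"
proof -
  \<comment> \<open>The representing vector of the linear form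
    \<open>differential A \<phi> p\<close>, given by its components in the basis.\<close>
  obtain u where u: "\<And>v. dh p u \<bullet> dh p v = (\<Sum>b\<in>Basis. differential A \<phi> p b *\<^sub>R b) \<bullet> v"
    using induced_metric_gram by blast
  have u': "dh p u \<bullet> dh p v = differential A \<phi> p v" for v
    unfolding u linear_euclidean_sum[OF linear_differential[OF \<phi>], of p v] inner_sum_left inner_scaleR_left
    by (rule sum.cong) (auto simp: inner_commute)
  have "grad A g \<phi> p = u"
    unfolding grad_def g induced_metric_def
    by (rule the_equality) (auto simp: u' intro: tangent_vector_eqI[of p])
  then show ?thesis using u' by simp
qed

lemma smooth_vf_grad:
  assumes g: "\<And>p v w. g p v w = induced_metric A h p v w" and \<phi>: "smooth_map A \<phi>"
  shows "smooth_vf A (grad A g \<phi>)"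
proof (rule smooth_vf_solution[OF _ grad_works[OF assms]])
  fix q a
  show "smooth_on (coord A q ` cdom A q)
      (\<lambda>x. differential A \<phi> (icoord A q x) (coord_vector A q (icoord A q x) a))"
    by (rule smooth_on_cong[OF open_coord_cdom _ smooth_on_deriv[OF smooth_on_chart[OF \<phi>]]])
       (auto simp: differential_coord_vector[OF _ smooth_map_has_differential[OF \<phi>], where q=q])
qed

text \<open>The difference is the image of the Lie bracket under \<open>dh p\<close>. In other
  words, the second fundamental form is symmetric.\<close>

lemma range_dh_commutator:
  assumes "smooth_vf A X" "smooth_vf A Y"
  shows "differential A (\<lambda>q. dh q (Y q)) p (X p) - differential A (\<lambda>q. dh q (X q)) p (Y p) \<in> range (dh p)"
  using differential_lie_bracket[OF smooth_h assms] by simp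

text \<open>The defining equation of \<open>D_set\<close> differentiates \<open>X\<close> in the
  direction of the gradient. Up to tangent vectors the two fields may be exchanged, which gives the
  derivative of the gradient along \<open>X\<close>.\<close>

lemma D_set_tangent:
  assumes g: "\<And>p v w. g p v w = induced_metric A h p v w" and D: "(\<phi>, \<beta>) \<in> D_set A g h"
  shows "differential A (\<lambda>q. dh q (grad A g \<phi> q) + \<beta> q) p v \<in> range (dh p)"
proof -
  have \<phi>: "smooth_map A \<phi>" and \<beta>: "smooth_map A \<beta>"
    using D by (auto simp: D_set_def normal_field_def)
  obtain X where X: "smooth_vf A X" "X p = v" by (rule smooth_vf_extension)
  note G = smooth_vf_grad[OF g \<phi>]
  have "normal_part A h p (differential A (\<lambda>q. dh q (X q)) p (grad A g \<phi> p) + differential A \<beta> p v) = 0"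
    using D X by (auto simp: D_set_def second_ff_def normal_connection_def normal_part_add)
  then have 1: "differential A (\<lambda>q. dh q (X q)) p (grad A g \<phi> p) + differential A \<beta> p v \<in> range (dh p)"
    by (simp add: normal_part_eq_0_iff)
  have 2: "differential A (\<lambda>q. dh q (grad A g \<phi> q)) p v - differential A (\<lambda>q. dh q (X q)) p (grad A g \<phi> p)
      \<in> range (dh p)"
    using range_dh_commutator[OF X(1) G, of p] X(2) by simp
  have "differential A (\<lambda>q. dh q (grad A g \<phi> q) + \<beta> q) p v
      = differential A (\<lambda>q. dh q (grad A g \<phi> q)) p v + differential A \<beta> p v"
    using has_differential_differential[OF has_differential_add[OF
          smooth_map_has_differential[OF smooth_map_dh[OF G]] smooth_map_has_differential[OF \<beta>]]] by metis
  then show ?thesis using subspace_add[OF subspace_range_dh 1 2] by (simp add: algebra_simps)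
qed

lemma parallel_tangent:
  assumes "\<And>X p. smooth_vf A X \<Longrightarrow> normal_connection A h X \<xi> p = 0"
  shows "differential A \<xi> p v \<in> range (dh p)"
proof -
  obtain X where X: "smooth_vf A X" "X p = v" by (rule smooth_vf_extension)
  show ?thesis using assms[OF X(1), of p] X(2) by (simp add: normal_connection_def normal_part_eq_0_iff)
qed

section \<open>The Levi-Civita connection of an induced metric\<close>

definition gauss_connection :: "('p \<Rightarrow> 'a) \<Rightarrow> ('p \<Rightarrow> 'a) \<Rightarrow> 'p \<Rightarrow> 'a" where
  "gauss_connection X Y p = tangent_part A h p (differential A (\<lambda>q. dh q (Y q)) p (X p))"

lemma smooth_vf_gauss_connection:
  "smooth_vf A X \<Longrightarrow> smooth_vf A Y \<Longrightarrow> smooth_vf A (gauss_connection X Y)"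
  unfolding gauss_connection_def[abs_def]
  by (intro smooth_vf_tangent_part smooth_map_differential smooth_map_dh)

lemma has_differential_dh:
  "smooth_vf A Y \<Longrightarrow> has_differential A (\<lambda>q. dh q (Y q)) (differential A (\<lambda>q. dh q (Y q)) p) p"
  using smooth_map_has_differential[OF smooth_map_dh] .

lemma linear_differential_dh: "smooth_vf A Y \<Longrightarrow> linear (differential A (\<lambda>q. dh q (Y q)) p)"
  using linear_differential[OF smooth_map_dh] .

lemma differential_induced_metric:
  assumes "smooth_vf A Y" "smooth_vf A Z"
  shows "differential A (\<lambda>q. induced_metric A h q (Y q) (Z q)) p v
    = differential A (\<lambda>q. dh q (Y q)) p v \<bullet> dh p (Z p) + dh p (Y p) \<bullet> differential A (\<lambda>q. dh q (Z q)) p v"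
  using has_differential_differential[OF has_differential_bilinear[OF bounded_bilinear_inner
        has_differential_dh[OF assms(1)] has_differential_dh[OF assms(2)]]]
  by (simp add: induced_metric_def)

text \<open>Linearity and the Leibniz rule are inherited from the Euclidean derivative,
  torsion-freeness is the bracket formula for \<open>h\<close>, and compatibility is the product
  rule, since the tangential part has the same inner products with tangent vectors.\<close>

lemma gauss_connection_levi_civita: "is_levi_civita A (induced_metric A h) gauss_connection"
  unfolding is_levi_civita_def
proof (intro conjI allI impI; (elim conjE)?)
  fix X Y assume "smooth_vf A X" "smooth_vf A Y"
  then show "smooth_vf A (gauss_connection X Y)" by (rule smooth_vf_gauss_connection)
next
  fix X X' Y p assume "smooth_vf A Y"
  from linear_add[OF linear_differential_dh[OF this]]
  show "gauss_connection (\<lambda>q. X q + X' q) Y p = gauss_connection X Y p + gauss_connection X' Y p"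
    by (simp add: gauss_connection_def linear_add[OF linear_tangent_part])
next
  fix X Y Y' p assume Y: "smooth_vf A Y" "smooth_vf A Y'"
  have "differential A (\<lambda>q. dh q (Y q + Y' q)) p
      = (\<lambda>v. differential A (\<lambda>q. dh q (Y q)) p v + differential A (\<lambda>q. dh q (Y' q)) p v)"
    unfolding dh_simps
    by (rule has_differential_differential[OF has_differential_add[OF Y[THEN has_differential_dh]]])
  then show "gauss_connection X (\<lambda>q. Y q + Y' q) p = gauss_connection X Y p + gauss_connection X Y' p"
    by (simp add: gauss_connection_def linear_add[OF linear_tangent_part])
next
  fix f :: "'p \<Rightarrow> real" and X Y p assume "smooth_vf A Y"
  from linear_scale[OF linear_differential_dh[OF this]]
  show "gauss_connection (\<lambda>q. f q *\<^sub>R X q) Y p = f p *\<^sub>R gauss_connection X Y p"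
    by (simp add: gauss_connection_def linear_scale[OF linear_tangent_part])
next
  fix f :: "'p \<Rightarrow> real" and X Y p assume f: "smooth_map A f" and Y: "smooth_vf A Y"
  have "differential A (\<lambda>q. dh q (f q *\<^sub>R Y q)) p
      = (\<lambda>v. f p *\<^sub>R differential A (\<lambda>q. dh q (Y q)) p v + differential A f p v *\<^sub>R dh p (Y p))"
    unfolding dh_simps
    by (rule has_differential_differential[OF has_differential_bilinear[OF bounded_bilinear_scaleR
            smooth_map_has_differential[OF f] has_differential_dh[OF Y]]])
  then show "gauss_connection X (\<lambda>q. f q *\<^sub>R Y q) p
      = differential A f p (X p) *\<^sub>R Y p + f p *\<^sub>R gauss_connection X Y p"
    by (simp add: gauss_connection_def linear_add[OF linear_tangent_part] linear_scale[OF linear_tangent_part])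
next
  fix X Y p and f :: "'p \<Rightarrow> real"
  assume XY: "smooth_vf A X" "smooth_vf A Y" and f: "smooth_map A f"
  have "gauss_connection X Y p - gauss_connection Y X p = lie_bracket A X Y p"
    unfolding gauss_connection_def linear_diff[OF linear_tangent_part, symmetric]
      differential_lie_bracket[OF smooth_h XY] by simp
  then show "differential A f p (gauss_connection X Y p - gauss_connection Y X p)
      = differential A (\<lambda>q. differential A f q (Y q)) p (X p)
      - differential A (\<lambda>q. differential A f q (X q)) p (Y p)"
    using differential_lie_bracket[OF f XY] by simp
next
  fix X Y Z p assume "smooth_vf A Y" "smooth_vf A Z"
  from differential_induced_metric[OF this]
  show "differential A (\<lambda>q. induced_metric A h q (Y q) (Z q)) p (X p)
     = induced_metric A h p (gauss_connection X Y p) (Z p) + induced_metric A h p (Y p) (gauss_connection X Z p)"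
    by (simp add: induced_metric_def gauss_connection_def inner_commute[of "dh p (Y p)"])
qed

text \<open>
  The components of \<open>h\<close> suffice as test functions for torsion-freeness. The difference to the
  Euclidean derivative is then symmetric in the first two and skew in the last two arguments.
\<close>

lemma levi_civita_unique:
  assumes nab: "is_levi_civita A (induced_metric A h) nab" and X: "smooth_vf A X" and Y: "smooth_vf A Y"
  shows "nab X Y p = gauss_connection X Y p"
proof -
  let ?D = "\<lambda>X Y p. differential A (\<lambda>q. dh q (Y q)) p (X p)"
  note nab' = nab[unfolded is_levi_civita_def]
  \<comment> \<open>As it is tested on tangent vectors only, the Euclidean derivative may stand here
    for its tangential part.\<close>
  define c where "c X Y Z = (dh p (nab X Y p) - ?D X Y p) \<bullet> dh p (Z p)" for X Y Z
  have skew: "c X Y Z = - c X Z Y" if "smooth_vf A X" "smooth_vf A Y" "smooth_vf A Z" for X Y Z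
  proof -
    have "differential A (\<lambda>q. induced_metric A h q (Y q) (Z q)) p (X p)
       = dh p (nab X Y p) \<bullet> dh p (Z p) + dh p (Y p) \<bullet> dh p (nab X Z p)"
      using nab'[THEN conjunct2, THEN conjunct2, THEN conjunct2, THEN conjunct2, THEN conjunct2, THEN conjunct2]
        that unfolding induced_metric_def by blast
    then show ?thesis
      using differential_induced_metric[OF that(2,3), of p "X p"]
      by (simp add: c_def inner_diff_left inner_commute[of "dh p (Y p)"])
  qed
  have torsion: "dh p (nab X Y p - nab Y X p) = ?D X Y p - ?D Y X p" if "smooth_vf A X" "smooth_vf A Y" for X Y
  proof (rule euclidean_eqI)
    fix b :: 'e assume "b \<in> Basis"
    let ?hb = "\<lambda>q. h q \<bullet> b"
    have hb: "smooth_map A ?hb" by (rule smooth_map_linear[OF bounded_linear_inner_left smooth_h])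
    have 1: "differential A ?hb q v = dh q v \<bullet> b" for q v
      using has_differential_differential[OF has_differential_linear[OF bounded_linear_inner_left
            smooth_map_has_differential[OF smooth_h]]] by metis
    have 2: "differential A (\<lambda>q. dh q (Y q) \<bullet> b) p v = differential A (\<lambda>q. dh q (Y q)) p v \<bullet> b"
      if "smooth_vf A Y" for Y v
      using has_differential_differential[OF has_differential_linear[OF bounded_linear_inner_left
            has_differential_dh[OF that]]] by metis
    have "differential A ?hb p (nab X Y p - nab Y X p)
       = differential A (\<lambda>q. differential A ?hb q (Y q)) p (X p)
       - differential A (\<lambda>q. differential A ?hb q (X q)) p (Y p)"
      using nab'[THEN conjunct2, THEN conjunct2, THEN conjunct2, THEN conjunct2, THEN conjunct2, THEN conjunct1]
        that hb by blast
    then show "dh p (nab X Y p - nab Y X p) \<bullet> b = (?D X Y p - ?D Y X p) \<bullet> b"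
      by (simp add: 1 2 that inner_diff_left)
  qed
  have sym: "c X Y Z = c Y X Z" if "smooth_vf A X" "smooth_vf A Y" for X Y Z
  proof -
    have "dh p (nab X Y p) - ?D X Y p = dh p (nab Y X p) - ?D Y X p"
      using torsion[OF that] by (simp add: dh_simps algebra_simps)
    then show ?thesis by (simp add: c_def)
  qed
  define W where "W q = nab X Y q - gauss_connection X Y q" for q
  have "smooth_vf A (nab X Y)"
    using nab'[THEN conjunct1] X Y by blast
  then have W: "smooth_vf A W"
    unfolding W_def by (intro smooth_vf_diff smooth_vf_gauss_connection X Y)
  \<comment> \<open>Skewness and symmetry are applied in turn, six steps in all, until the original
    term returns with the opposite sign. With \<open>W\<close> the difference of the two connections
    this makes \<open>W\<close> a null vector at \<open>p\<close>.\<close>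
  have "c X Y W = - c X W Y" by (rule skew[OF X Y W])
  also have "\<dots> = - c W X Y" using sym[OF X W] by simp
  also have "\<dots> = c W Y X" using skew[OF W X Y] by simp
  also have "\<dots> = c Y W X" by (rule sym[OF W Y])
  also have "\<dots> = - c Y X W" by (rule skew[OF Y W X])
  also have "\<dots> = - c X Y W" using sym[OF X Y] by simp
  finally have "c X Y W = 0" by simp
  moreover have "?D X Y p \<bullet> dh p v = dh p (gauss_connection X Y p) \<bullet> dh p v" for v
    by (simp add: gauss_connection_def)
  ultimately have "(dh p (nab X Y p) - dh p (gauss_connection X Y p)) \<bullet> dh p (W p) = 0"
    by (simp add: c_def inner_diff_left)
  then have "dh p (nab X Y p) = dh p (gauss_connection X Y p)" by (simp add: W_def dh_simps)
  then show ?thesis using inj_dh by (simp add: inj_eq)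
qed

text \<open>\<open>levi_civita\<close> is a choice. Existence of \<open>gauss_connection\<close>
  makes the chosen operator a Levi-Civita connection, and uniqueness fixes its values on smooth
  fields.\<close>

lemma inner_levi_civita:
  assumes "smooth_vf A X" "smooth_vf A Y"
  shows "dh p (levi_civita A (induced_metric A h) X Y p) \<bullet> dh p v
    = differential A (\<lambda>q. dh q (Y q)) p (X p) \<bullet> dh p v"
proof -
  have "is_levi_civita A (induced_metric A h) (levi_civita A (induced_metric A h))"
    unfolding levi_civita_def by (rule someI[where P="is_levi_civita A (induced_metric A h)"])
      (rule gauss_connection_levi_civita)
  from levi_civita_unique[OF this assms] show ?thesis by (simp add: gauss_connection_def)
qed

end

section \<open>Products\<close>

lemma smooth_on_fst: "open S \<Longrightarrow> smooth_on S fst" and smooth_on_snd: "open S \<Longrightarrow> smooth_on S snd"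
  using smooth_on_linear[OF bounded_linear_fst _ smooth_on_id] smooth_on_linear[OF bounded_linear_snd _ smooth_on_id]
  by auto

lemma smooth_on_Pair:
  assumes "open S" "smooth_on S f" "smooth_on S g"
  shows "smooth_on S (\<lambda>x. (f x, g x))"
proof -
  have "bounded_linear (\<lambda>x. (x, 0))" "bounded_linear (\<lambda>x. (0, x))"
    by (simp_all add: bounded_linear_Pair bounded_linear_ident bounded_linear_zero)
  then have "smooth_on S (\<lambda>x. (f x, 0) + (0, g x))"
    by (intro smooth_on_add assms(1) smooth_on_linear[OF _ assms(1) assms(2)] smooth_on_linear[OF _ assms(1) assms(3)])
  then show ?thesis by simp
qed

locale manifold_product = M0: manifold A0 + M1: manifold A1
  for A0 :: "('p::{t2_space, second_countable_topology}, 'a::euclidean_space) atlas"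
    and A1 :: "('q::{t2_space, second_countable_topology}, 'b::euclidean_space) atlas"
begin

abbreviation "A \<equiv> prod_atlas A0 A1"

lemma cdom_prod: "cdom A (p, q) = cdom A0 p \<times> cdom A1 q"
  by (simp add: cdom_def prod_atlas_def)

lemma coord_prod: "coord A (p, q) z = (coord A0 p (fst z), coord A1 q (snd z))"
  by (simp add: coord_def prod_atlas_def split: prod.split)

lemma coord_image_prod: "coord A (p, q) ` (U \<times> V) = (coord A0 p ` U) \<times> (coord A1 q ` V)"
  by (auto simp: coord_prod image_iff)

lemma icoord_prod:
  assumes "z \<in> (coord A0 p ` cdom A0 p) \<times> (coord A1 q ` cdom A1 q)"
  shows "icoord A (p, q) z = (icoord A0 p (fst z), icoord A1 q (snd z))"
  unfolding icoord_def[of A]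
proof (rule inv_into_f_eq)
  show "inj_on (coord A (p, q)) (cdom A (p, q))"
    by (rule inj_on_inverseI[where g="\<lambda>z. (icoord A0 p (fst z), icoord A1 q (snd z))"])
       (auto simp: cdom_prod coord_prod)
qed (use assms in \<open>auto simp: cdom_prod coord_prod\<close>)

lemma manifold_prod: "smooth_manifold A"
  unfolding smooth_manifold_def
proof (intro conjI allI)
  fix z :: "'p \<times> 'q"
  obtain p q where z: "z = (p, q)" by (cases z)
  let ?S0 = "coord A0 p ` cdom A0 p" and ?S1 = "coord A1 q ` cdom A1 q"
  have img: "coord A z ` cdom A z = ?S0 \<times> ?S1" by (simp add: z cdom_prod coord_image_prod)
  show "z \<in> cdom A z" "open (cdom A z)" by (auto simp: z cdom_prod open_Times M0.open_cdom M1.open_cdom)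
  show "open (coord A z ` cdom A z)"
    unfolding img by (intro open_Times M0.open_coord_cdom M1.open_coord_cdom)
  note H = M0.homeomorphism_coord[of p] M1.homeomorphism_coord[of q]
  have "continuous_on (cdom A z) (\<lambda>z. (coord A0 p (fst z), coord A1 q (snd z)))"
    using H by (auto simp: z cdom_prod homeomorphism_def intro!: continuous_intros
        continuous_on_compose2[of "cdom A0 p" "coord A0 p"] continuous_on_compose2[of "cdom A1 q" "coord A1 q"])
  then have c: "continuous_on (cdom A z) (coord A z)"
    by (rule continuous_on_eq) (simp add: z coord_prod)
  have "continuous_on (?S0 \<times> ?S1) (\<lambda>z. (icoord A0 p (fst z), icoord A1 q (snd z)))"
    using H by (auto simp: homeomorphism_def intro!: continuous_intros
        continuous_on_compose2[of ?S0 "icoord A0 p"] continuous_on_compose2[of ?S1 "icoord A1 q"])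
  then have ic: "continuous_on (?S0 \<times> ?S1) (icoord A z)"
    by (rule continuous_on_eq) (simp add: z icoord_prod)
  show "homeomorphism (cdom A z) (coord A z ` cdom A z) (coord A z) (icoord A z)"
  proof (rule homeomorphismI[OF c _ _ _ ])
    show "continuous_on (coord A z ` cdom A z) (icoord A z)" using ic img by simp
    show "icoord A z ` coord A z ` cdom A z \<subseteq> cdom A z"
      unfolding img by (auto simp: z icoord_prod cdom_prod)
    show "icoord A z (coord A z w) = w" if "w \<in> cdom A z" for w
      using that by (auto simp: z cdom_prod coord_prod icoord_prod)
    show "coord A z (icoord A z y) = y" if "y \<in> coord A z ` cdom A z" for y
      using that unfolding img by (auto simp: z coord_prod icoord_prod)
  qed simp
next
  fix z w :: "'p \<times> 'q"
  obtain p q p' q' where z: "z = (p, q)" and w: "w = (p', q')" by (cases z, cases w) auto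
  let ?T0 = "coord A0 p ` (cdom A0 p \<inter> cdom A0 p')" and ?T1 = "coord A1 q ` (cdom A1 q \<inter> cdom A1 q')"
  have T: "coord A z ` (cdom A z \<inter> cdom A w) = ?T0 \<times> ?T1"
    by (simp add: z w cdom_prod Times_Int_Times coord_image_prod)
  have o: "open (?T0 \<times> ?T1)"
    using M0.open_coord_image[OF M0.open_cdom, of p p'] M1.open_coord_image[OF M1.open_cdom, of q q']
    by (simp add: open_Times Int_commute)
  have "smooth_on (?T0 \<times> ?T1) (\<lambda>x. ((coord A0 p' \<circ> icoord A0 p) (fst x), (coord A1 q' \<circ> icoord A1 q) (snd x)))"
    by (rule smooth_on_Pair[OF o])
       (rule smooth_on_compose[OF o M0.smooth_transition smooth_on_fst[OF o]] smooth_on_compose[OF o M1.smooth_transition smooth_on_snd[OF o]], force)+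
  then show "smooth_on (coord A z ` (cdom A z \<inter> cdom A w)) (coord A w \<circ> icoord A z)"
    unfolding T
  proof (rule smooth_on_cong[OF o, rotated])
    fix x assume "x \<in> ?T0 \<times> ?T1"
    then have "x \<in> (coord A0 p ` cdom A0 p) \<times> (coord A1 q ` cdom A1 q)" by auto
    then show "((coord A0 p' \<circ> icoord A0 p) (fst x), (coord A1 q' \<circ> icoord A1 q) (snd x))
        = (coord A w \<circ> icoord A z) x"
      by (simp add: z w icoord_prod coord_prod)
  qed
qed

sublocale P: manifold A
  by unfold_locales (rule manifold_prod)

text \<open>Composition with the inclusion of a leaf. It reduces differentiation along
  \<open>M\<^sub>0\<close> in the product to calculus on \<open>A0\<close> with the point of the
  other factor fixed.\<close>

lemma has_differential_slice0:
  assumes "has_differential A F L (p, q)"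
  shows "has_differential A0 (\<lambda>x. F (x, q)) (\<lambda>v. L (v, 0)) p"
proof -
  have "(F \<circ> icoord A (p, q) has_derivative L) (at (coord A0 p p, coord A1 q q))"
    using assms by (simp add: has_differential_def coord_prod)
  moreover have "((\<lambda>x. (x, coord A1 q q)) has_derivative (\<lambda>v. (v, 0))) (at (coord A0 p p))"
    by (auto intro!: derivative_eq_intros)
  ultimately have "((\<lambda>x. (F \<circ> icoord A (p, q)) (x, coord A1 q q)) has_derivative (\<lambda>v. L (v, 0))) (at (coord A0 p p))"
    using has_derivative_compose[where f="\<lambda>x. (x, coord A1 q q)"] by fast
  then have "((\<lambda>x. F (x, q)) \<circ> icoord A0 p has_derivative (\<lambda>v. L (v, 0))) (at (coord A0 p p))"
    by (rule has_derivative_transform_within_open[OF _ M0.open_coord_cdom[of p]])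
       (auto simp: icoord_prod)
  then show ?thesis by (simp add: has_differential_def)
qed

lemma has_differential_slice1:
  assumes "has_differential A F L (p, q)"
  shows "has_differential A1 (\<lambda>y. F (p, y)) (\<lambda>v. L (0, v)) q"
proof -
  have "(F \<circ> icoord A (p, q) has_derivative L) (at (coord A0 p p, coord A1 q q))"
    using assms by (simp add: has_differential_def coord_prod)
  moreover have "((\<lambda>y. (coord A0 p p, y)) has_derivative (\<lambda>v. (0, v))) (at (coord A1 q q))"
    by (auto intro!: derivative_eq_intros)
  ultimately have "((\<lambda>y. (F \<circ> icoord A (p, q)) (coord A0 p p, y)) has_derivative (\<lambda>v. L (0, v))) (at (coord A1 q q))"
    using has_derivative_compose[where f="\<lambda>y. (coord A0 p p, y)"] by fast
  then have "((\<lambda>y. F (p, y)) \<circ> icoord A1 q has_derivative (\<lambda>v. L (0, v))) (at (coord A1 q q))"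
    by (rule has_derivative_transform_within_open[OF _ M1.open_coord_cdom[of q]])
       (auto simp: icoord_prod)
  then show ?thesis by (simp add: has_differential_def)
qed

lemma smooth_map_fst:
  assumes "smooth_map A0 F"
  shows "smooth_map A (\<lambda>z. F (fst z))"
  unfolding smooth_map_def
proof
  fix z :: "'p \<times> 'q"
  obtain p q where z: "z = (p, q)" by (cases z)
  let ?S = "(coord A0 p ` cdom A0 p) \<times> (coord A1 q ` cdom A1 q)"
  have S: "coord A z ` cdom A z = ?S" by (simp add: z cdom_prod coord_image_prod)
  have o: "open ?S" by (intro open_Times M0.open_coord_cdom M1.open_coord_cdom)
  have "smooth_on ?S (\<lambda>x. (F \<circ> icoord A0 p) (fst x))"
    by (rule smooth_on_compose[OF o M0.smooth_on_chart[OF assms] smooth_on_fst[OF o]]) auto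
  then show "smooth_on (coord A z ` cdom A z) ((\<lambda>z. F (fst z)) \<circ> icoord A z)"
    unfolding S by (rule smooth_on_cong[OF o, rotated]) (simp add: z icoord_prod)
qed

lemma smooth_map_snd:
  assumes "smooth_map A1 F"
  shows "smooth_map A (\<lambda>z. F (snd z))"
  unfolding smooth_map_def
proof
  fix z :: "'p \<times> 'q"
  obtain p q where z: "z = (p, q)" by (cases z)
  let ?S = "(coord A0 p ` cdom A0 p) \<times> (coord A1 q ` cdom A1 q)"
  have S: "coord A z ` cdom A z = ?S" by (simp add: z cdom_prod coord_image_prod)
  have o: "open ?S" by (intro open_Times M0.open_coord_cdom M1.open_coord_cdom)
  have "smooth_on ?S (\<lambda>x. (F \<circ> icoord A1 q) (snd x))"
    by (rule smooth_on_compose[OF o M1.smooth_on_chart[OF assms] smooth_on_snd[OF o]]) auto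
  then show "smooth_on (coord A z ` cdom A z) ((\<lambda>z. F (snd z)) \<circ> icoord A z)"
    unfolding S by (rule smooth_on_cong[OF o, rotated]) (simp add: z icoord_prod)
qed

lemma differential_coord_prod_fst:
  assumes "z \<in> cdom A (p, q)"
  shows "differential A (coord A (p, q)) z (v, 0) = (differential A0 (coord A0 p) (fst z) v, 0)"
proof -
  obtain x y where z: "z = (x, y)" by (cases z)
  then have xy: "x \<in> cdom A0 p" "y \<in> cdom A1 q" using assms by (auto simp: cdom_prod)
  note D = has_differential_slice0[OF P.smooth_map_on_has_differential[OF P.smooth_map_on_coord assms, unfolded z]]
  have "has_differential A0 (\<lambda>x. (coord A0 p x, coord A1 q y)) (\<lambda>v. (differential A0 (coord A0 p) x v, 0)) x"
    using M0.smooth_map_on_has_differential[OF M0.smooth_map_on_coord xy(1)]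
    by (auto simp: has_differential_def o_def intro!: has_derivative_Pair)
  from has_differential_differential[OF this] has_differential_differential[OF D]
  show ?thesis by (simp add: coord_prod z fun_eq_iff)
qed

text \<open>The local frame consists of the coordinate fields of a chart of \<open>A0\<close>. In
  any other chart their components are derivatives of a transition map, hence smooth.\<close>

lemma subbundle_net0: "subbundle A net0"
  unfolding subbundle_def
proof (rule exI[of _ "DIM('a)"], intro conjI allI)
  fix z :: "'p \<times> 'q"
  have net0: "net0 z = (\<lambda>x. (x, 0)) ` (UNIV :: 'a set)" by (auto simp: net0_def)
  have lin: "linear (\<lambda>x::'a. (x, 0::'b))" by (simp add: linear_iff)
  show "subspace (net0 z :: ('a \<times> 'b) set)"
    unfolding net0 by (intro linear_subspace_image lin subspace_UNIV)
  show "dim (net0 z :: ('a \<times> 'b) set) = DIM('a)"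
    unfolding net0 by (subst dim_image_eq[OF lin]) (auto simp: inj_on_def)
  obtain b where b: "bij_betw b {0..<DIM('a)} (Basis :: 'a set)"
    using ex_bij_betw_nat_finite finite_Basis by blast
  obtain p q where z: "z = (p, q)" by (cases z)
  \<comment> \<open>Frames are indexed by natural numbers, so \<open>b\<close> enumerates the basis;
    the second component is 0 along the other factor.\<close>
  define e where "e i w = (coord_vector A0 p (fst w) (b i), 0::'b)" for i :: nat and w :: "'p \<times> 'q"
  show "\<exists>U e. open U \<and> z \<in> U \<and> (\<forall>i<DIM('a). smooth_vf_on A U (e i))
      \<and> (\<forall>w\<in>U. (net0 w :: ('a \<times> 'b) set) = span ((\<lambda>i. e i w) ` {..<DIM('a)}))"
  proof (intro exI conjI allI impI ballI)
    show "open (cdom A z)" "z \<in> cdom A z" using P.open_cdom by auto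
  next
    fix i
    show "smooth_vf_on A (cdom A z) (e i)"
      unfolding smooth_vf_on_def
    proof
      fix w :: "'p \<times> 'q"
      obtain p' q' where w: "w = (p', q')" by (cases w)
      let ?U = "coord A0 p' ` (cdom A0 p' \<inter> cdom A0 p)"
      let ?T = "coord A w ` (cdom A z \<inter> cdom A w)"
      have o: "open ?T" by (rule P.open_coord_image[OF P.open_cdom])
      have T: "?T = ?U \<times> coord A1 q' ` (cdom A1 q \<inter> cdom A1 q')"
        by (simp add: z w cdom_prod Times_Int_Times coord_image_prod Int_commute)
      have T_dom: "x \<in> (coord A0 p' ` cdom A0 p') \<times> (coord A1 q' ` cdom A1 q')"
        "icoord A0 p' (fst x) \<in> cdom A0 p \<inter> cdom A0 p'" if "x \<in> ?T" for x
        using that unfolding T by auto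
      let ?\<tau> = "\<lambda>x. (coord A0 p \<circ> icoord A0 p') (fst x)"
      have \<tau>: "smooth_on ?T ?\<tau>"
        by (rule smooth_on_compose[OF o M0.smooth_transition smooth_on_fst[OF o]]) (auto simp: T)
      have "smooth_on ?T (\<lambda>x. frechet_derivative (coord A0 p' \<circ> icoord A0 p) (at (?\<tau> x)) (b i))"
        by (rule smooth_on_compose[OF o smooth_on_deriv[OF M0.smooth_transition] \<tau>])
           (use T_dom(2) in \<open>auto simp: image_iff\<close>)
      from smooth_on_Pair[OF o this smooth_on_const[where c=0]]
      show "smooth_on ?T ((\<lambda>p. differential A (coord A w) p (e i p)) \<circ> icoord A w)"
      proof (rule smooth_on_cong[OF o, rotated])
        fix x assume x: "x \<in> ?T"
        define y where "y = icoord A0 p' (fst x)"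
        have y: "y \<in> cdom A0 p" "y \<in> cdom A0 p'" using T_dom(2)[OF x] by (auto simp: y_def)
        have ix: "icoord A w x = (y, icoord A1 q' (snd x))"
          unfolding w y_def by (rule icoord_prod[OF T_dom(1)[OF x]])
        have "icoord A w x \<in> cdom A w" using x by auto
        from differential_coord_prod_fst[OF this[unfolded w], of "coord_vector A0 p y (b i)"]
        have "differential A (coord A w) (icoord A w x) (e i (icoord A w x))
            = (differential A0 (coord A0 p') y (coord_vector A0 p y (b i)), 0)"
          by (simp add: e_def ix flip: w)
        also have "differential A0 (coord A0 p') y (coord_vector A0 p y (b i))
            = frechet_derivative (coord A0 p' \<circ> icoord A0 p) (at (?\<tau> x)) (b i)"
          using M0.differential_coord_vector[OF y(1) M0.smooth_map_on_has_differential[OF M0.smooth_map_on_coord y(2)]]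
          by (simp add: y_def)
        finally show "(frechet_derivative (coord A0 p' \<circ> icoord A0 p) (at (?\<tau> x)) (b i), 0)
            = ((\<lambda>p. differential A (coord A w) p (e i p)) \<circ> icoord A w) x" by simp
      qed
    qed
  next
    fix w assume "w \<in> cdom A z"
    then have w: "fst w \<in> cdom A0 p" by (auto simp: z cdom_prod)
    let ?L = "\<lambda>a. (coord_vector A0 p (fst w) a, 0::'b)"
    have L: "linear ?L"
      using M0.linear_coord_vector[OF w] by (simp add: linear_iff)
    have "(\<lambda>i. e i w) ` {..<DIM('a)} = ?L ` Basis"
      using b by (simp add: e_def bij_betw_def lessThan_atLeast0 image_image flip: image_image[of ?L b])
    then have "span ((\<lambda>i. e i w) ` {..<DIM('a)}) = ?L ` UNIV"
      by (simp add: linear_span_image[OF L])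
    also have "\<dots> = net0 w"
    proof -
      have "(v, 0) \<in> range ?L" for v
        using M0.coord_vector_differential[OF w, of v] by (metis rangeI)
      then show ?thesis by (auto simp: net0_def)
    qed
    finally show "net0 w = span ((\<lambda>i. e i w) ` {..<DIM('a)})" by simp
  qed
qed

end

section \<open>Reflections\<close>

text \<open>Dividing by \<open>n \<bullet> n\<close> allows \<open>n\<close> of any length. For
  \<open>n = 0\<close> the map is the identity, because division by 0 gives 0.\<close>

definition reflect :: "'e::real_inner \<Rightarrow> 'e \<Rightarrow> 'e" where
  "reflect n w = w - (2 * (w \<bullet> n) / (n \<bullet> n)) *\<^sub>R n"

lemma reflect_reflect [simp]: "reflect n (reflect n w) = w"
  by (cases "n = 0") (auto simp: reflect_def inner_diff_left)

lemma inner_reflect [simp]: "reflect n v \<bullet> reflect n w = v \<bullet> w"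
  by (cases "n = 0") (auto simp: reflect_def inner_diff_left inner_diff_right inner_commute)

lemma linear_reflect: "linear (reflect n)"
  by (auto simp: linear_iff reflect_def inner_add_left algebra_simps add_divide_distrib)

text \<open>One formula for two uses: the tube, with \<open>a = f1\<close> and
  \<open>c = \<phi>\<close>, and the reflected field \<open>reflect (F x) (a x)\<close>, with
  \<open>c = a \<bullet> F\<close>. The last term measures how far \<open>c'\<close> is from
  \<open>a' \<bullet> F\<close>.\<close>

lemma inversion_has_derivative:
  fixes a F :: "'x::real_normed_vector \<Rightarrow> 'e::real_inner"
  assumes a: "(a has_derivative a') (at x)" and c: "(c has_derivative c') (at x)"
    and F: "(F has_derivative F') (at x)" and "F x \<noteq> 0"
  shows "((\<lambda>x. a x - (2 * c x / (F x \<bullet> F x)) *\<^sub>R F x) has_derivative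
    (\<lambda>v. reflect (F x) (a' v - (2 * c x / (F x \<bullet> F x)) *\<^sub>R F' v)
       - (2 * (c' v - a' v \<bullet> F x) / (F x \<bullet> F x)) *\<^sub>R F x)) (at x)"
proof -
  have N: "F x \<bullet> F x \<noteq> 0" using assms(4) by simp
  have "((\<lambda>x. a x - (2 * c x / (F x \<bullet> F x)) *\<^sub>R F x) has_derivative
    (\<lambda>v. a' v - ((2 * c x / (F x \<bullet> F x)) *\<^sub>R F' v
      + ((2 * c' v * (F x \<bullet> F x) - 2 * c x * (2 * (F' v \<bullet> F x))) / (F x \<bullet> F x)\<^sup>2) *\<^sub>R F x))) (at x)"
    using N by (auto intro!: derivative_eq_intros a c F simp: inner_commute power2_eq_square field_simps)
  moreover have "a' v - ((2 * c x / (F x \<bullet> F x)) *\<^sub>R F' v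
      + ((2 * c' v * (F x \<bullet> F x) - 2 * c x * (2 * (F' v \<bullet> F x))) / (F x \<bullet> F x)\<^sup>2) *\<^sub>R F x)
    = reflect (F x) (a' v - (2 * c x / (F x \<bullet> F x)) *\<^sub>R F' v)
       - (2 * (c' v - a' v \<bullet> F x) / (F x \<bullet> F x)) *\<^sub>R F x" for v
  proof -
    \<comment> \<open>The coefficient from the quotient rule is split into the one that completes
      the reflection and the remaining defect.\<close>
    have "(2 * c' v * (F x \<bullet> F x) - 2 * c x * (2 * (F' v \<bullet> F x))) / (F x \<bullet> F x)\<^sup>2
      = 2 * ((a' v - (2 * c x / (F x \<bullet> F x)) *\<^sub>R F' v) \<bullet> F x) / (F x \<bullet> F x)
        + 2 * (c' v - a' v \<bullet> F x) / (F x \<bullet> F x)"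
      using N by (simp add: inner_diff_left field_simps power2_eq_square)
    then show ?thesis by (simp add: reflect_def algebra_simps)
  qed
  ultimately show ?thesis by simp
qed

lemma (in manifold) has_differential_inversion:
  fixes a F :: "'p \<Rightarrow> 'e::real_inner"
  assumes "has_differential A a a' p" "has_differential A c c' p" "has_differential A F F' p" "F p \<noteq> 0"
  shows "has_differential A (\<lambda>p. a p - (2 * c p / (F p \<bullet> F p)) *\<^sub>R F p)
    (\<lambda>v. reflect (F p) (a' v - (2 * c p / (F p \<bullet> F p)) *\<^sub>R F' v)
       - (2 * (c' v - a' v \<bullet> F p) / (F p \<bullet> F p)) *\<^sub>R F p) p"
  using inversion_has_derivative[OF assms(1-3)[unfolded has_differential_def o_def]] assms(4)
  by (simp add: has_differential_def o_def)

lemma (in manifold) has_differential_reflect: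
  fixes w F :: "'p \<Rightarrow> 'e::real_inner"
  assumes "has_differential A w w' p" "has_differential A F F' p" "F p \<noteq> 0"
  shows "has_differential A (\<lambda>p. reflect (F p) (w p))
    (\<lambda>v. reflect (F p) (w' v - (2 * (w p \<bullet> F p) / (F p \<bullet> F p)) *\<^sub>R F' v)
       - (2 * (w p \<bullet> F' v) / (F p \<bullet> F p)) *\<^sub>R F p) p"
  using has_differential_inversion[OF assms(1)
      has_differential_bilinear[OF bounded_bilinear_inner assms(1,2)] assms(2,3)]
  by (simp add: reflect_def)

section \<open>Ribaucour partial tubes\<close>

locale ribaucour =
  fixes A0 :: "('p::{t2_space, second_countable_topology}, 'a::euclidean_space) atlas"
    and A1 :: "('q::{t2_space, second_countable_topology}, 'b::euclidean_space) atlas"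
    and g0 :: "('p, 'a) metric"
    and g1 :: "('q, 'b) metric"
    and f0 :: "'p \<Rightarrow> real ^ 'k"
    and f1 :: "'q \<Rightarrow> 'e::euclidean_space"
    and \<xi> :: "'k \<Rightarrow> 'q \<Rightarrow> 'e"
    and \<phi> :: "'q \<Rightarrow> real"
    and \<beta> :: "'q \<Rightarrow> 'e"
    and f :: "'p \<times> 'q \<Rightarrow> 'e"
  assumes M0: "smooth_manifold A0" and M1: "smooth_manifold A1"
    and tube: "ribaucour_partial_tube A0 g0 A1 g1 f0 f1 \<xi> \<phi> \<beta> f"
begin

sublocale manifold_product A0 A1
  using M0 M1 by unfold_locales

sublocale M0: immersed A0 f0
  by unfold_locales (use tube in \<open>simp add: ribaucour_partial_tube_def isometric_immersion_def\<close>)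

sublocale M1: immersed A1 f1
  by unfold_locales (use tube in \<open>simp add: ribaucour_partial_tube_def isometric_immersion_def\<close>)

sublocale P: immersed "prod_atlas A0 A1" f
  by unfold_locales (use tube[unfolded ribaucour_partial_tube_def] in blast)

abbreviation "grad1 q \<equiv> M1.dh q (grad A1 g1 \<phi> q)"

definition F :: "'p \<times> 'q \<Rightarrow> 'e" where
  "F z = grad1 (snd z) + \<beta> (snd z) + Psi \<xi> (snd z) (f0 (fst z))"

abbreviation R :: "'p \<times> 'q \<Rightarrow> 'e \<Rightarrow> 'e" where
  "R z \<equiv> reflect (F z)"

text \<open>This is \<open>2 \<nu> \<phi>\<close>, the factor of \<open>\<F>\<close> in the
  definition of the tube.\<close>

abbreviation \<kappa> :: "'p \<times> 'q \<Rightarrow> real" where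
  "\<kappa> z \<equiv> 2 * \<phi> (snd z) / (F z \<bullet> F z)"

lemma g1: "g1 q v w = induced_metric A1 f1 q v w"
  using tube by (simp add: ribaucour_partial_tube_def isometric_immersion_def)

lemma D_set: "(\<phi>, \<beta>) \<in> D_set A1 g1 f1"
  using tube by (simp add: ribaucour_partial_tube_def)

lemma smooth_\<phi>: "smooth_map A1 \<phi>" and normal_\<beta>: "normal_field A1 f1 \<beta>"
  using D_set by (auto simp: D_set_def)

lemma smooth_\<beta>: "smooth_map A1 \<beta>"
  using normal_\<beta> by (simp add: normal_field_def)

lemma parallel: "parallel_orthonormal_frame A1 f1 \<xi>"
  using tube by (simp add: ribaucour_partial_tube_def)

lemma smooth_\<xi>: "smooth_map A1 (\<xi> i)" and \<xi>_normal: "\<xi> i q \<in> normal_space A1 f1 q"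
  and \<xi>_parallel: "differential A1 (\<xi> i) q v \<in> range (M1.dh q)"
  using parallel M1.parallel_tangent by (auto simp: parallel_orthonormal_frame_def normal_field_def)

lemma inner_Psi_dh [simp]: "Psi \<xi> q y \<bullet> M1.dh q v = 0" "M1.dh q v \<bullet> Psi \<xi> q y = 0"
proof -
  show "Psi \<xi> q y \<bullet> M1.dh q v = 0"
    by (simp add: Psi_def inner_sum_left M1.normal_space_inner[OF \<xi>_normal])
  then show "M1.dh q v \<bullet> Psi \<xi> q y = 0" by (simp add: inner_commute)
qed

lemma F_nonzero: "F z \<noteq> 0"
  using tube by (cases z) (simp add: ribaucour_partial_tube_def ribaucour_F_def F_def)

lemma f_eq: "f z = f1 (snd z) - \<kappa> z *\<^sub>R F z"
  using tube
  by (cases z) (simp add: ribaucour_partial_tube_def ribaucour_map_def ribaucour_F_def F_def Let_def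
      power2_norm_eq_inner divide_inverse mult.commute mult.left_commute)

text \<open>\<open>\<beta>\<close> and the values of \<open>Psi\<close> are normal to
  \<open>f1\<close>, so only the gradient contributes. Consequently \<open>d\<phi>\<close> is the
  inner product of \<open>f1_*\<close> with \<open>F\<close>.\<close>

lemma inner_F_dh: "M1.dh (snd z) v \<bullet> F z = M1.dh (snd z) v \<bullet> grad1 (snd z)"
  using normal_\<beta> M1.normal_space_inner
  by (simp add: F_def inner_add_right normal_field_def inner_commute[of "M1.dh (snd z) v" "\<beta> (snd z)"])

lemma smooth_grad1: "smooth_map A1 (\<lambda>q. grad1 q)"
  by (rule M1.smooth_map_dh[OF M1.smooth_vf_grad[OF g1 smooth_\<phi>]])

lemma smooth_F: "smooth_map A F"
proof -
  have "smooth_map A (\<lambda>z. grad1 (snd z) + \<beta> (snd z))"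
    by (intro P.smooth_map_add smooth_map_snd smooth_grad1 smooth_\<beta>)
  moreover have "smooth_map A (\<lambda>z. f0 (fst z) $ i *\<^sub>R \<xi> i (snd z))" for i
    by (rule P.smooth_map_scaleR[OF smooth_map_fst[OF M0.smooth_map_linear[OF bounded_linear_vec_nth M0.smooth_h]]
          smooth_map_snd[OF smooth_\<xi>]])
  ultimately show ?thesis
    unfolding F_def[abs_def] Psi_def by (intro P.smooth_map_add[of "\<lambda>z. grad1 (snd z) + \<beta> (snd z)"] P.smooth_map_sum)
qed

lemma has_differential_F0:
  "has_differential A0 (\<lambda>x. F (x, q)) (\<lambda>v. Psi \<xi> q (M0.dh p v)) p"
proof -
  have "bounded_linear (Psi \<xi> q)"
    unfolding linear_conv_bounded_linear[symmetric] Psi_def[abs_def]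
    by (rule linearI) (simp_all add: scaleR_add_left sum.distrib scaleR_sum_right)
  from M0.has_differential_add[OF M0.has_differential_const
      M0.has_differential_linear[OF this M0.smooth_map_has_differential[OF M0.smooth_h]]]
  show ?thesis by (simp add: F_def)
qed

text \<open>With the point of \<open>M\<^sub>0\<close> fixed, the coefficients of the
  \<open>\<xi> i\<close> are constant, so tangency follows termwise from
  \<open>D_set_tangent\<close> and from parallelism of the frame.\<close>

lemma has_differential_F1:
  obtains F' where "has_differential A1 (\<lambda>q. F (p, q)) F' q" "\<And>v. F' v \<in> range (M1.dh q)"
proof
  have 1: "has_differential A1 (\<lambda>q. grad1 q + \<beta> q) (differential A1 (\<lambda>q. grad1 q + \<beta> q) q) q"
    by (rule M1.smooth_map_has_differential[OF M1.smooth_map_add[OF smooth_grad1 smooth_\<beta>]])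
  have 2: "has_differential A1 (\<lambda>q. Psi \<xi> q (f0 p)) (\<lambda>v. \<Sum>i\<in>UNIV. f0 p $ i *\<^sub>R differential A1 (\<xi> i) q v) q"
    unfolding Psi_def
    by (rule M1.has_differential_sum, rule M1.has_differential_linear[OF bounded_linear_scaleR_right],
        rule M1.smooth_map_has_differential[OF smooth_\<xi>])
  show "has_differential A1 (\<lambda>q. F (p, q)) (\<lambda>v. differential A1 (\<lambda>q. grad1 q + \<beta> q) q v
      + (\<Sum>i\<in>UNIV. f0 p $ i *\<^sub>R differential A1 (\<xi> i) q v)) q"
    using M1.has_differential_add[OF 1 2] by (simp add: F_def)
  show "differential A1 (\<lambda>q. grad1 q + \<beta> q) q v + (\<Sum>i\<in>UNIV. f0 p $ i *\<^sub>R differential A1 (\<xi> i) q v)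
      \<in> range (M1.dh q)" for v
    by (intro subspace_add subspace_sum subspace_scale M1.subspace_range_dh \<xi>_parallel
        M1.D_set_tangent[OF g1 D_set])
qed

section \<open>The differential of the tube along the two factors\<close>

lemma f_slice0: "P.dh (p, q) (t, 0) = - \<kappa> (p, q) *\<^sub>R R (p, q) (Psi \<xi> q (M0.dh p t))"
proof -
  \<comment> \<open>Along \<open>M\<^sub>0\<close> both \<open>f1\<close> and \<open>\<phi>\<close>
    are constant, so the inversion formula retains only the term with the derivative of
    \<open>F\<close>.\<close>
  have "has_differential A0 (\<lambda>x. f1 q - (2 * \<phi> q / (F (x, q) \<bullet> F (x, q))) *\<^sub>R F (x, q))
     (\<lambda>v. R (p, q) (0 - (2 * \<phi> q / (F (p, q) \<bullet> F (p, q))) *\<^sub>R Psi \<xi> q (M0.dh p v))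
       - (2 * (0 - 0 \<bullet> F (p, q)) / (F (p, q) \<bullet> F (p, q))) *\<^sub>R F (p, q)) p"
    by (rule M0.has_differential_inversion[OF M0.has_differential_const M0.has_differential_const
          has_differential_F0 F_nonzero])
  then have "has_differential A0 (\<lambda>x. f (x, q)) (\<lambda>v. - \<kappa> (p, q) *\<^sub>R R (p, q) (Psi \<xi> q (M0.dh p v))) p"
    by (simp add: f_eq linear_neg[OF linear_reflect] linear_scale[OF linear_reflect])
  from has_differential_unique[OF has_differential_slice0[OF P.smooth_map_has_differential[OF P.smooth_h]] this]
  show ?thesis .
qed

text \<open>
  \<open>f\<^sub>* (0, y) = R (f\<^sub>1\<^sub>* y - \<kappa> (\<partial>\<^sub>y F))\<close>, and \<open>\<partial>\<^sub>y F\<close> is tangent to \<open>f\<^sub>1\<close> by the choice of \<open>(\<phi>, \<beta>)\<close>;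
  as \<open>f\<close> is an immersion, the argument of \<open>R\<close> takes every value in the tangent space of \<open>f\<^sub>1\<close>.
\<close>

lemma f_slice1:
  "range (\<lambda>y. R (p, q) (P.dh (p, q) (0, y))) = range (M1.dh q)"
proof -
  obtain F' where F': "has_differential A1 (\<lambda>q. F (p, q)) F' q" "\<And>v. F' v \<in> range (M1.dh q)"
    using has_differential_F1 by blast
  let ?K = "\<lambda>y. R (p, q) (P.dh (p, q) (0, y))"
  have "has_differential A1 (\<lambda>q. f1 q - (2 * \<phi> q / (F (p, q) \<bullet> F (p, q))) *\<^sub>R F (p, q))
     (\<lambda>v. R (p, q) (M1.dh q v - (2 * \<phi> q / (F (p, q) \<bullet> F (p, q))) *\<^sub>R F' v)
       - (2 * (differential A1 \<phi> q v - M1.dh q v \<bullet> F (p, q)) / (F (p, q) \<bullet> F (p, q))) *\<^sub>R F (p, q)) q"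
    by (rule M1.has_differential_inversion[OF M1.smooth_map_has_differential[OF M1.smooth_h]
          M1.smooth_map_has_differential[OF smooth_\<phi>] F'(1) F_nonzero])
  \<comment> \<open>This cancels the last term of the inversion formula.\<close>
  moreover have "differential A1 \<phi> q v = M1.dh q v \<bullet> F (p, q)" for v
    using inner_F_dh[of "(p, q)" v] M1.grad_works[OF g1 smooth_\<phi>, of q v] by (simp add: inner_commute)
  ultimately have "has_differential A1 (\<lambda>q. f (p, q)) (\<lambda>v. R (p, q) (M1.dh q v - \<kappa> (p, q) *\<^sub>R F' v)) q"
    by (simp add: f_eq)
  from has_differential_unique[OF has_differential_slice1[OF P.smooth_map_has_differential[OF P.smooth_h]] this]
  have "P.dh (p, q) (0, y) = R (p, q) (M1.dh q y - \<kappa> (p, q) *\<^sub>R F' y)" for y .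
  then have K: "?K y = M1.dh q y - \<kappa> (p, q) *\<^sub>R F' y" for y by simp
  then have mem: "?K y \<in> range (M1.dh q)" for y
    unfolding K by (intro subspace_diff subspace_scale M1.subspace_range_dh F'(2) rangeI)
  have "linear (\<lambda>y. (0::'a, y))" by (simp add: linear_iff)
  then have linK: "linear ?K"
    using linear_compose[OF linear_compose[OF _ P.linear_dh] linear_reflect] by (simp add: o_def)
  \<comment> \<open>Pulled back by \<open>f1_*\<close>, the map \<open>?K\<close> becomes an
    endomorphism of the model space of \<open>M\<^sub>1\<close>, for which injectivity gives
    surjectivity.\<close>
  let ?T = "\<lambda>y. tangent_part A1 f1 q (?K y)"
  have dhT: "M1.dh q (?T y) = ?K y" for y
    using M1.dh_tangent_part M1.normal_part_eq_0_iff mem by simp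
  have "linear ?T" using linear_compose[OF linK M1.linear_tangent_part] by (simp add: o_def)
  moreover have "inj ?T"
  proof (rule injI)
    fix y y' assume "?T y = ?T y'"
    from arg_cong[OF this, of "M1.dh q"] have "?K y = ?K y'" unfolding dhT .
    from arg_cong[OF this, of "R (p, q)"] have "P.dh (p, q) (0, y) = P.dh (p, q) (0, y')" by simp
    from injD[OF P.inj_dh this] show "y = y'" by simp
  qed
  ultimately have surj: "surj ?T" by (rule linear_injective_imp_surjective) simp
  have "M1.dh q u \<in> range ?K" for u
  proof -
    obtain y where "u = ?T y" using surjD[OF surj] by blast
    then have "M1.dh q u = ?K y" by (simp only: dhT)
    then show ?thesis by blast
  qed
  then show ?thesis using mem by blast
qed

lemma f_slice1_mem: "R (p, q) (P.dh (p, q) (0, y)) \<in> range (M1.dh q)"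
  using f_slice1 by blast

lemma f_slice1_surj:
  assumes "u \<in> range (M1.dh q)" obtains y where "P.dh (p, q) (0, y) = R (p, q) u"
  using assms unfolding f_slice1[of p q, symmetric] by auto

text \<open>At a zero of \<open>\<phi>\<close> the factor \<open>\<kappa>\<close> vanishes and the
  differential of \<open>f\<close> is zero along \<open>M\<^sub>0\<close>, which has positive
  dimension; this contradicts the immersion property.\<close>

lemma \<phi>_nonzero: "\<phi> q \<noteq> 0"
proof
  assume "\<phi> q = 0"
  then have "P.dh (p, q) (t, 0) = 0" for p t by (simp add: f_slice0)
  moreover obtain b :: 'a where "b \<in> Basis" using nonempty_Basis by blast
  \<comment> \<open>\<open>undefined\<close> is just some point of \<open>M\<^sub>0\<close>, a type
    being nonempty.\<close>
  ultimately have "P.dh (undefined, q) (b, 0) = P.dh (undefined, q) (0, 0)" by simp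
  from injD[OF P.inj_dh this] have "b = 0" by simp
  then show False using \<open>b \<in> Basis\<close> by simp
qed

text \<open>Both vectors are images under the isometry \<open>R\<close>, one of a vector in the span
  of the normal frame and one of a vector tangent to \<open>f1\<close>.\<close>

lemma orthogonal: "P.dh z (t, 0) \<bullet> P.dh z (0, y) = 0"
proof -
  obtain p q where z: "z = (p, q)" by (cases z)
  obtain u where u: "R (p, q) (P.dh (p, q) (0, y)) = M1.dh q u" using f_slice1_mem by blast
  have "P.dh z (0, y) = R (p, q) (M1.dh q u)" by (simp add: z flip: u)
  then show ?thesis by (simp add: z f_slice0)
qed

lemma reflect_Psi: "R (p, q) (Psi \<xi> q (M0.dh p t)) = - (F (p, q) \<bullet> F (p, q) / (2 * \<phi> q)) *\<^sub>R P.dh (p, q) (t, 0)"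
  using \<phi>_nonzero[of q] F_nonzero[of "(p, q)"] by (simp add: f_slice0)

text \<open>In the derivative of a reflected field, the term along \<open>F\<close> vanishes because
  \<open>w\<close> is tangent and \<open>Psi\<close> is normal. The other extra term is a multiple
  of \<open>R\<close> applied to a value of \<open>Psi\<close>, hence of the differential of
  \<open>f\<close> along \<open>M\<^sub>0\<close>.\<close>

lemma has_differential_reflect_tangent:
  assumes w: "has_differential A0 w w' p" and tan: "\<And>x. w x \<in> range (M1.dh q)"
  shows "has_differential A0 (\<lambda>x. R (x, q) (w x))
    (\<lambda>t. R (p, q) (w' t) + ((w p \<bullet> grad1 q) / \<phi> q) *\<^sub>R P.dh (p, q) (t, 0)) p"
proof -
  obtain u where u: "w p = M1.dh q u" using tan by auto
  have "has_differential A0 (\<lambda>x. R (x, q) (w x))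
    (\<lambda>t. R (p, q) (w' t - (2 * (w p \<bullet> F (p, q)) / (F (p, q) \<bullet> F (p, q))) *\<^sub>R Psi \<xi> q (M0.dh p t))
       - (2 * (w p \<bullet> Psi \<xi> q (M0.dh p t)) / (F (p, q) \<bullet> F (p, q))) *\<^sub>R F (p, q)) p"
    by (rule M0.has_differential_reflect[OF w has_differential_F0 F_nonzero])
  then show ?thesis
    using \<phi>_nonzero[of q] F_nonzero[of "(p, q)"] inner_F_dh[of "(p, q)" u]
    by (simp add: u linear_diff[OF linear_reflect] linear_scale[OF linear_reflect] reflect_Psi)
qed

text \<open>By orthogonality the complement of \<open>E\<^sub>0\<close> is \<open>E\<^sub>1\<close>,
  so the orthogonal decomposition is the one into product components.\<close>

lemma perp_part_net0: "perp_part (induced_metric A f) net0 z w = (0, snd w)"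
  unfolding perp_part_def
proof (rule the_equality)
  show "(0, snd w) \<in> perp (induced_metric A f) net0 z \<and> w - (0, snd w) \<in> net0 z"
    by (cases w) (auto simp: perp_def net0_def induced_metric_def orthogonal)
next
  fix u assume u: "u \<in> perp (induced_metric A f) net0 z \<and> w - u \<in> net0 z"
  then have snd: "snd u = snd w" by (cases u; cases w) (auto simp: net0_def)
  have "P.dh z (fst u, 0) \<bullet> P.dh z u = 0"
    using u by (auto simp: perp_def net0_def induced_metric_def)
  moreover have "P.dh z u = P.dh z (fst u, 0) + P.dh z (0, snd u)"
    by (simp flip: linear_add[OF P.linear_dh])
  ultimately have "P.dh z (fst u, 0) = P.dh z (0, 0)"
    by (simp add: inner_add_right orthogonal linear_0[OF P.linear_dh] flip: zero_prod_def)
  from injD[OF P.inj_dh this] have "fst u = 0" by simp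
  then show "u = (0, snd w)" using snd by (simp add: prod_eq_iff)
qed

section \<open>Orthogonality and adaptedness of the product net\<close>

lemma orthogonal_net: "orthogonal_net (induced_metric A f) net0 net1"
  by (auto simp: orthogonal_net_def net0_def net1_def induced_metric_def orthogonal)

lemma section_net0:
  assumes "X \<in> sections A net0" shows "smooth_vf A X \<and> X z = (fst (X z), 0)"
proof -
  have "smooth_vf A X" "X z \<in> net0 z" using assms unfolding sections_def by blast+
  then show ?thesis by (cases "X z") (auto simp: net0_def)
qed

lemma section_net1:
  assumes "X \<in> sections A net1" shows "smooth_vf A X \<and> X z = (0, snd (X z))"
proof -
  have "smooth_vf A X" "X z \<in> net1 z" using assms unfolding sections_def by blast+
  then show ?thesis by (cases "X z") (auto simp: net1_def)
qed

lemma has_differential_dh_slice0: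
  assumes "smooth_vf A Y"
  shows "has_differential A0 (\<lambda>x. P.dh (x, q) (Y (x, q)))
    (\<lambda>t. differential A (\<lambda>z. P.dh z (Y z)) (p, q) (t, 0)) p"
  by (rule has_differential_slice0[OF P.has_differential_dh[OF assms]])

lemma adapted: "adapted A f net0 net1"
  unfolding adapted_def
proof (intro ballI allI)
  fix X Y :: "'p \<times> 'q \<Rightarrow> 'a \<times> 'b" and z :: "'p \<times> 'q"
  assume X: "X \<in> sections A net0" and Y: "Y \<in> sections A net1"
  obtain p q where z: "z = (p, q)" by (cases z)
  define t where "t = fst (X z)"
  have Xz: "X z = (t, 0)" using section_net0[OF X, of z] unfolding t_def by blast
  have Y1: "smooth_vf A Y" "Y z = (0, snd (Y z))" for z
    using section_net1[OF Y] by blast+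
  \<comment> \<open>Reflecting back moves the image of \<open>Y\<close> along the whole leaf into
    one fixed space, the tangent space of \<open>f1\<close> at \<open>q\<close>.\<close>
  define w where "w x = R (x, q) (P.dh (x, q) (Y (x, q)))" for x
  have w_tan: "w x \<in> range (M1.dh q)" for x
    unfolding w_def by (subst Y1(2)) (rule f_slice1_mem)
  note D = has_differential_dh_slice0[OF Y1(1), of q p]
  obtain w' where w': "has_differential A0 w w' p"
    using M0.has_differential_reflect[OF D has_differential_F0[where q=q] F_nonzero] unfolding w_def[symmetric] by blast
  \<comment> \<open>\<open>R\<close> is an involution, so reflecting \<open>w\<close> once more
    recovers the image of \<open>Y\<close>.\<close>
  have "has_differential A0 (\<lambda>x. P.dh (x, q) (Y (x, q)))
      (\<lambda>t. R (p, q) (w' t) + ((w p \<bullet> grad1 q) / \<phi> q) *\<^sub>R P.dh (p, q) (t, 0)) p"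
    using has_differential_reflect_tangent[OF w' w_tan] by (simp add: w_def)
  from has_differential_unique[OF D this, of t]
  have eq: "differential A (\<lambda>z. P.dh z (Y z)) z (X z)
      = R (p, q) (w' t) + ((w p \<bullet> grad1 q) / \<phi> q) *\<^sub>R P.dh (p, q) (t, 0)"
    by (simp add: Xz) (simp add: z)
  \<comment> \<open>A curve of vectors in a fixed subspace has its derivative there, and
    \<open>R\<close> maps that subspace onto the image of \<open>E\<^sub>1\<close>.\<close>
  have "w' t \<in> range (M1.dh q)"
    by (rule M0.has_differential_in_subspace[OF w' M1.subspace_range_dh w_tan])
  then obtain y where "P.dh (p, q) (0, y) = R (p, q) (w' t)" by (rule f_slice1_surj)
  then have "differential A (\<lambda>z. P.dh z (Y z)) z (X z) \<in> range (P.dh z)"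
    unfolding eq unfolding z by (intro subspace_add subspace_scale P.subspace_range_dh) (metis rangeI)+
  then show "second_ff A f X Y z = 0"
    by (simp add: second_ff_def P.normal_part_eq_0_iff)
qed

text \<open>
  The mean curvature vector field \<open>Z\<close> satisfies \<open>f\<^sub>* Z = R \<zeta>\<close>, where \<open>\<zeta>\<close> does not depend on the
  point of \<open>M\<^sub>0\<close>; this makes \<open>E\<^sub>0\<close> spherical.
\<close>

definition \<zeta> :: "'q \<Rightarrow> 'e" where
  "\<zeta> q = - (grad1 q /\<^sub>R \<phi> q)"

lemma \<zeta>_tangent: "\<zeta> q \<in> range (M1.dh q)"
  unfolding \<zeta>_def by (intro subspace_neg subspace_scale M1.subspace_range_dh rangeI)

lemma smooth_reflect_\<zeta>: "smooth_map A (\<lambda>z. R z (\<zeta> (snd z)))"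
proof -
  have \<zeta>: "smooth_map A (\<lambda>z. \<zeta> (snd z))"
    unfolding \<zeta>_def
    by (rule smooth_map_snd[OF M1.smooth_map_linear[OF bounded_linear_minus[OF bounded_linear_ident]
            M1.smooth_map_divide[OF smooth_grad1 smooth_\<phi> \<phi>_nonzero]]])
  have "smooth_map A (\<lambda>z. ((2 * (\<zeta> (snd z) \<bullet> F z)) *\<^sub>R F z) /\<^sub>R (F z \<bullet> F z))"
    by (rule P.smooth_map_divide[OF P.smooth_map_scaleR[OF P.smooth_map_linear[OF bounded_linear_mult_right
              P.smooth_map_inner[OF \<zeta> smooth_F]] smooth_F] P.smooth_map_inner[OF smooth_F smooth_F]])
       (simp add: F_nonzero)
  from P.smooth_map_diff[OF \<zeta> this] show ?thesis
    by (simp add: reflect_def divide_inverse mult.commute)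
qed

text \<open>Tested on \<open>E\<^sub>1\<close>, the \<open>E\<^sub>0\<close> component of the
  Levi-Civita derivative drops out by orthogonality, and what remains is a Euclidean derivative
  along the leaf.\<close>

lemma inner_levi_civita_net1:
  assumes T: "T \<in> sections A net0" and X: "smooth_vf A X"
  shows "P.dh (p, q) (0, snd (levi_civita A (induced_metric A f) T X (p, q))) \<bullet> P.dh (p, q) (0, y)
    = differential A (\<lambda>z. P.dh z (X z)) (p, q) (fst (T (p, q)), 0) \<bullet> P.dh (p, q) (0, y)"
proof -
  let ?L = "levi_civita A (induced_metric A f) T X (p, q)"
  have "P.dh (p, q) ?L = P.dh (p, q) (fst ?L, 0) + P.dh (p, q) (0, snd ?L)"
    by (simp flip: linear_add[OF P.linear_dh])
  then have "P.dh (p, q) (0, snd ?L) \<bullet> P.dh (p, q) (0, y) = P.dh (p, q) ?L \<bullet> P.dh (p, q) (0, y)"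
    by (simp add: inner_add_left orthogonal)
  also have "\<dots> = differential A (\<lambda>z. P.dh z (X z)) (p, q) (T (p, q)) \<bullet> P.dh (p, q) (0, y)"
    by (rule P.inner_levi_civita[OF conjunct1[OF section_net0[OF T]] X])
  also have "T (p, q) = (fst (T (p, q)), 0)" using section_net0[OF T] by blast
  finally show ?thesis .
qed

text \<open>Inner products with \<open>E\<^sub>0\<close> vanish by orthogonality, so testing on
  \<open>E\<^sub>1\<close> alone already gives nondegeneracy.\<close>

lemma net1_vector_eqI:
  assumes "\<And>y. P.dh z (0, b) \<bullet> P.dh z (0, y) = P.dh z (0, b') \<bullet> P.dh z (0, y)"
  shows "b = b'"
proof -
  have "(0, b) = (0::'a, b')"
  proof (rule P.tangent_vector_eqI[of z])
    fix v
    have v: "P.dh z v = P.dh z (fst v, 0) + P.dh z (0, snd v)"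
      by (simp flip: linear_add[OF P.linear_dh])
    show "P.dh z (0, b) \<bullet> P.dh z v = P.dh z (0, b') \<bullet> P.dh z v"
      unfolding v inner_add_right inner_commute[of "P.dh z (0, b)" "P.dh z (fst v, 0)"]
        inner_commute[of "P.dh z (0, b')" "P.dh z (fst v, 0)"]
      by (simp add: orthogonal assms)
  qed
  then show ?thesis by simp
qed

text \<open>
  The leaves of \<open>E\<^sub>0\<close> are umbilical: for fixed \<open>w\<close> tangent to \<open>f\<^sub>1\<close>, differentiate
  \<open>\<langle>f\<^sub>* S, R w\<rangle> = 0\<close> along the leaf.
\<close>

lemma inner_derivative_net0:
  assumes S: "S \<in> sections A net0" and w: "w \<in> range (M1.dh q)"
  shows "differential A (\<lambda>z. P.dh z (S z)) (p, q) (t, 0) \<bullet> R (p, q) w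
    = - ((w \<bullet> grad1 q) / \<phi> q) * (P.dh (p, q) (S (p, q)) \<bullet> P.dh (p, q) (t, 0))"
proof -
  have S1: "smooth_vf A S" "S z = (fst (S z), 0)" for z
    using section_net0[OF S] by blast+
  obtain u where u: "w = M1.dh q u" using w by auto
  have "P.dh (x, q) (S (x, q)) \<bullet> R (x, q) w = 0" for x
    using f_slice0[of x q "fst (S (x, q))"] by (subst S1(2)) (simp add: u)
  then have 0: "(\<lambda>x. P.dh (x, q) (S (x, q)) \<bullet> R (x, q) w) = (\<lambda>x. 0)" by blast
  \<comment> \<open>Since \<open>w\<close> is constant along the leaf, its reflection varies only by
    a multiple of the differential of \<open>f\<close> along \<open>M\<^sub>0\<close>.\<close>
  have "has_differential A0 (\<lambda>x. R (x, q) w)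
    (\<lambda>t. R (p, q) 0 + ((w \<bullet> grad1 q) / \<phi> q) *\<^sub>R P.dh (p, q) (t, 0)) p"
    by (rule has_differential_reflect_tangent[OF M0.has_differential_const w])
  from M0.has_differential_bilinear[OF bounded_bilinear_inner has_differential_dh_slice0[OF S1(1)] this]
  have "has_differential A0 (\<lambda>x. P.dh (x, q) (S (x, q)) \<bullet> R (x, q) w)
     (\<lambda>t. P.dh (p, q) (S (p, q)) \<bullet> (R (p, q) 0 + ((w \<bullet> grad1 q) / \<phi> q) *\<^sub>R P.dh (p, q) (t, 0))
        + differential A (\<lambda>z. P.dh z (S z)) (p, q) (t, 0) \<bullet> R (p, q) w) p" .
  from has_differential_unique[OF this[unfolded 0] M0.has_differential_const, of t]
  show ?thesis by (simp add: linear_0[OF linear_reflect])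
qed

lemma spherical: "spherical A (induced_metric A f) net0"
proof -
  let ?g = "induced_metric A f"
  have "\<exists>y. P.dh z (0, y) = R z (\<zeta> (snd z))" for z
    using f_slice1_surj[OF \<zeta>_tangent] by (metis prod.collapse)
  \<comment> \<open>The field is chosen pointwise; its smoothness comes from that of its image
    \<open>R z (\<zeta> (snd z))\<close>, through \<open>smooth_vf_lift\<close>.\<close>
  then obtain y where y: "\<And>z. P.dh z (0, y z) = R z (\<zeta> (snd z))" by metis
  define Z where "Z z = (0::'a, y z)" for z
  have dZ: "P.dh z (Z z) = R z (\<zeta> (snd z))" for z by (simp add: Z_def y)
  have Z: "smooth_vf A Z"
    by (rule P.smooth_vf_lift) (simp add: dZ smooth_reflect_\<zeta>)
  have umb: "umbilical_with A ?g net0 Z"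
    unfolding umbilical_with_def
  proof (intro conjI ballI allI)
    show "subbundle A net0" by (rule subbundle_net0)
    show "Z \<in> sections A (perp ?g net0)"
      using Z by (auto simp: sections_def perp_def net0_def Z_def induced_metric_def orthogonal)
  next
    fix T S and z :: "'p \<times> 'q" assume T: "T \<in> sections A net0" and S: "S \<in> sections A net0"
    obtain p q where z: "z = (p, q)" by (cases z)
    have T1: "T (p, q) = (fst (T (p, q)), 0)" using section_net0[OF T] by blast
    have "snd (levi_civita A ?g T S (p, q)) = ?g (p, q) (T (p, q)) (S (p, q)) *\<^sub>R y (p, q)"
    proof (rule net1_vector_eqI[of "(p, q)"])
      fix y'
      \<comment> \<open>Each test vector in \<open>E\<^sub>1\<close> has an image of the form
        \<open>R w\<close> with \<open>w\<close> tangent to \<open>f1\<close>, as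
        \<open>inner_derivative_net0\<close> requires.\<close>
      obtain u where u: "R (p, q) (P.dh (p, q) (0, y')) = M1.dh q u" using f_slice1_mem by blast
      then have R: "P.dh (p, q) (0, y') = R (p, q) (M1.dh q u)" by (metis reflect_reflect)
      have "P.dh (p, q) (0, snd (levi_civita A ?g T S (p, q))) \<bullet> P.dh (p, q) (0, y')
          = differential A (\<lambda>z. P.dh z (S z)) (p, q) (fst (T (p, q)), 0) \<bullet> R (p, q) (M1.dh q u)"
        using inner_levi_civita_net1[OF T conjunct1[OF section_net0[OF S]], of p q y'] R by simp
      also have "\<dots> = - ((M1.dh q u \<bullet> grad1 q) / \<phi> q) * ?g (p, q) (T (p, q)) (S (p, q))"
        using inner_derivative_net0[OF S, of "M1.dh q u" q p "fst (T (p, q))"]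
        by (simp add: induced_metric_def inner_commute flip: T1)
      \<comment> \<open>The factor \<open>- (w \<bullet> grad1 q) / \<phi> q\<close> is
        \<open>\<zeta> q \<bullet> w\<close>, and the isometry \<open>R\<close> may be applied to
        both vectors.\<close>
      also have "\<dots> = ?g (p, q) (T (p, q)) (S (p, q)) * (R (p, q) (\<zeta> q) \<bullet> R (p, q) (M1.dh q u))"
        by (simp add: \<zeta>_def inner_commute divide_inverse)
      also have "\<dots> = P.dh (p, q) (0, ?g (p, q) (T (p, q)) (S (p, q)) *\<^sub>R y (p, q)) \<bullet> P.dh (p, q) (0, y')"
      proof -
        have "P.dh (p, q) (0, c *\<^sub>R y (p, q)) = c *\<^sub>R R (p, q) (\<zeta> q)" for c
          using linear_scale[OF P.linear_dh, of "(p, q)" c "(0, y (p, q))"] y[of "(p, q)"] by simp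
        then show ?thesis by (simp add: R)
      qed
      finally show "P.dh (p, q) (0, snd (levi_civita A ?g T S (p, q))) \<bullet> P.dh (p, q) (0, y')
        = P.dh (p, q) (0, ?g (p, q) (T (p, q)) (S (p, q)) *\<^sub>R y (p, q)) \<bullet> P.dh (p, q) (0, y')" .
    qed
    then show "perp_part ?g net0 z (levi_civita A ?g T S z) = ?g z (T z) (S z) *\<^sub>R Z z"
      by (simp add: perp_part_net0 Z_def z)
  qed
  moreover have "perp_part ?g net0 z (levi_civita A ?g T Z z) = 0" if T: "T \<in> sections A net0" for T and z :: "'p \<times> 'q"
  proof -
    obtain p q where z: "z = (p, q)" by (cases z)
    \<comment> \<open>\<open>\<zeta> q\<close> is constant along the leaf, so the image of
      \<open>Z\<close> is differentiated by the reflection rule with derivative 0 inside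
      \<open>R\<close>; the result is orthogonal to \<open>E\<^sub>1\<close>.\<close>
    have "has_differential A0 (\<lambda>x. R (x, q) (\<zeta> q))
      (\<lambda>t. R (p, q) 0 + ((\<zeta> q \<bullet> grad1 q) / \<phi> q) *\<^sub>R P.dh (p, q) (t, 0)) p"
      by (rule has_differential_reflect_tangent[OF M0.has_differential_const \<zeta>_tangent])
    from has_differential_unique[OF has_differential_dh_slice0[OF Z, of q p, unfolded dZ snd_conv] this]
    have D: "differential A (\<lambda>z. P.dh z (Z z)) (p, q) (t, 0)
        = ((\<zeta> q \<bullet> grad1 q) / \<phi> q) *\<^sub>R P.dh (p, q) (t, 0)" for t
      by (simp add: dZ linear_0[OF linear_reflect])
    have "snd (levi_civita A ?g T Z (p, q)) = 0"
    proof (rule net1_vector_eqI[of "(p, q)"])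
      show "P.dh (p, q) (0, snd (levi_civita A ?g T Z (p, q))) \<bullet> P.dh (p, q) (0, y')
          = P.dh (p, q) (0, 0) \<bullet> P.dh (p, q) (0, y')" for y'
        using inner_levi_civita_net1[OF T Z, of p q y'] linear_0[OF P.linear_dh, of "(p, q)"]
        by (simp add: D orthogonal zero_prod_def)
    qed
    then show ?thesis by (simp add: perp_part_net0 z zero_prod_def)
  qed
  ultimately show ?thesis by (auto simp: spherical_def)
qed

end

theorem corollary6:
  fixes A0 :: "('p::{t2_space, second_countable_topology}, 'a::euclidean_space) atlas"
    and A1 :: "('q::{t2_space, second_countable_topology}, 'b::euclidean_space) atlas"
    and g0 :: "('p, 'a) metric"
    and g1 :: "('q, 'b) metric"
    and f0 :: "'p \<Rightarrow> real ^ 'k"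
    and f1 :: "'q \<Rightarrow> real ^ 'm"
    and \<xi> :: "'k \<Rightarrow> 'q \<Rightarrow> real ^ 'm"
    and \<phi> :: "'q \<Rightarrow> real"
    and \<beta> :: "'q \<Rightarrow> real ^ 'm"
    and f :: "'p \<times> 'q \<Rightarrow> real ^ 'm"
  assumes "smooth_manifold A0" and "riemannian_metric A0 g0"
    and "smooth_manifold A1" and "riemannian_metric A1 g1"
    and "ribaucour_partial_tube A0 g0 A1 g1 f0 f1 \<xi> \<phi> \<beta> f"
  shows "orthogonal_net (induced_metric (prod_atlas A0 A1) f) net0 net1 \<and>
         adapted (prod_atlas A0 A1) f net0 net1 \<and>
         spherical (prod_atlas A0 A1) (induced_metric (prod_atlas A0 A1) f) net0"
proof -
  interpret ribaucour A0 A1 g0 g1 f0 f1 \<xi> \<phi> \<beta> f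
    using assms by unfold_locales
  show ?thesis using orthogonal_net adapted spherical by blast
qed

end
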